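(* Let $\mathbb{F}$ be a field of characteristic zero, let $\boxtimes$ be the tetrahedron Lie algebra over $\mathbb{F}$, and let $O$ be the Onsager Lie algebra, identified with the Lie subalgebra of $\boxtimes$ generated by $x_{12}$ and $x_{03}$. Then, in $\boxtimes$, $$\begin{aligned} O&=(X_{03}\cap O)+(X_{31}\cap O)+(X_{12}\cap O)\\ &=(X_{30}\cap O)+(X_{02}\cap O)+(X_{21}\cap O)\\ &=(X_{03}\cap O)+(X_{32}\cap O)+(X_{21}\cap O)\\ &=(X_{30}\cap O)+(X_{01}\cap O)+(X_{12}\cap O), \end{aligned}$$ and each of these four sums is direct. Here $X_{rs}$ denotes the subspace of $x_{rs}$-like elements of $\boxtimes$.
   Context: $\mathbb{I}=\{0,1,2,3\}$. The tetrahedron algebra $\boxtimes$ is the Lie algebra over $\mathbb{F}$ with generators $\{x_{ij}\mid i,j\in\mathbb{I},\ i\neq j\}$ and relations: (i) $x_{ij}+x_{ji}=0$ for distinct $i,j\in\mathbb{I}$; (ii) $[x_{ij},x_{jk}]=2x_{ij}+2x_{jk}$ for mutually distinct $i,j,k\in\mathbb{I}$; (iii) $[x_{ij},[x_{ij},[x_{ij},x_{kh}]]]=4[x_{ij},x_{kh}]$ for mutually distinct $h,i,j,k\in\mathbb{I}$. For distinct $i,j\in\mathbb{I}$, an element $\xi\in\boxtimes$ is called $x_{ij}$-like if $[x_{ij},\xi]=0$ and $[x_{kh},[x_{kh},[x_{kh},\xi]]]=4[x_{kh},\xi]$, where $h,i,j,k$ are mutually distinct elements of $\mathbb{I}$.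 $X_{ij}$ is the set of all $x_{ij}$-like elements of $\boxtimes$; it is a subspace of $\boxtimes$ and $X_{ij}=X_{ji}$. The Onsager Lie algebra $O$ is the Lie algebra over $\mathbb{F}$ with generators $A,B$ and relations $[A,[A,[A,B]]]=4[A,B]$, $[B,[B,[B,A]]]=4[B,A]$. There is an injective Lie algebra homomorphism $O\to\boxtimes$ with $A\mapsto x_{12}$, $B\mapsto x_{03}$; $O$ is identified with its image. *)

theory Defs
  imports
    Complex_Main
    "HOL-Library.Numeral_Type"
    "HOL-Library.Set_Algebras"
begin

section \<open>Lie algebras\<close>

locale lie_algebra = vector_space scale
  for scale :: "'f::field \<Rightarrow> 'a::ab_group_add \<Rightarrow> 'a" +
  fixes bracket :: "'a \<Rightarrow> 'a \<Rightarrow> 'a"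
  assumes bracket_add_left: "bracket (x + y) z = bracket x z + bracket y z"
    and bracket_add_right: "bracket x (y + z) = bracket x y + bracket x z"
    and bracket_scale_left: "bracket (scale a x) y = scale a (bracket x y)"
    and bracket_scale_right: "bracket x (scale a y) = scale a (bracket x y)"
    and bracket_self: "bracket x x = 0"
    and jacobi: "bracket x (bracket y z) + bracket y (bracket z x) + bracket z (bracket x y) = 0"
begin

definition lie_subalgebra :: "'a set \<Rightarrow> bool" where
  "lie_subalgebra S \<longleftrightarrow> subspace S \<and> (\<forall>x\<in>S. \<forall>y\<in>S. bracket x y \<in> S)"

end

section \<open>Lie algebras given by generators and relations\<close>

text \<open>
  The Lie algebra with generators \<^term>\<open>g\<close> of a type and defining relations
  \<^term>\<open>s = t\<close>, for \<^term>\<open>R s t\<close>, is the set of all formal Lie expressions modulo the least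
  congruence that contains the axioms of a Lie algebra and the relations.
\<close>

datatype ('f, 'g) lie_term =
    Gen 'g
  | Zero
  | Plus "('f, 'g) lie_term" "('f, 'g) lie_term"
  | Scale 'f "('f, 'g) lie_term"
  | Bracket "('f, 'g) lie_term" "('f, 'g) lie_term"

inductive lie_eq ::
  "(('f::field, 'g) lie_term \<Rightarrow> ('f, 'g) lie_term \<Rightarrow> bool)
    \<Rightarrow> ('f, 'g) lie_term \<Rightarrow> ('f, 'g) lie_term \<Rightarrow> bool"
  for R where
  rel: "R s t \<Longrightarrow> lie_eq R s t"
| refl: "lie_eq R s s"
| sym: "lie_eq R s t \<Longrightarrow> lie_eq R t s"
| trans: "lie_eq R s t \<Longrightarrow> lie_eq R t u \<Longrightarrow> lie_eq R s u"
| Plus_cong: "lie_eq R s s' \<Longrightarrow> lie_eq R t t' \<Longrightarrow> lie_eq R (Plus s t) (Plus s' t')"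
| Scale_cong: "lie_eq R s s' \<Longrightarrow> lie_eq R (Scale a s) (Scale a s')"
| Bracket_cong: "lie_eq R s s' \<Longrightarrow> lie_eq R t t' \<Longrightarrow> lie_eq R (Bracket s t) (Bracket s' t')"
| Plus_assoc: "lie_eq R (Plus (Plus s t) u) (Plus s (Plus t u))"
| Plus_comm: "lie_eq R (Plus s t) (Plus t s)"
| Plus_Zero: "lie_eq R (Plus Zero s) s"
| Plus_neg: "lie_eq R (Plus (Scale (-1) s) s) Zero"
| Scale_Plus: "lie_eq R (Scale a (Plus s t)) (Plus (Scale a s) (Scale a t))"
| Scale_add: "lie_eq R (Scale (a + b) s) (Plus (Scale a s) (Scale b s))"
| Scale_mult: "lie_eq R (Scale a (Scale b s)) (Scale (a * b) s)"
| Scale_one: "lie_eq R (Scale 1 s) s"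
| Bracket_Plus_left: "lie_eq R (Bracket (Plus s t) u) (Plus (Bracket s u) (Bracket t u))"
| Bracket_Plus_right: "lie_eq R (Bracket s (Plus t u)) (Plus (Bracket s t) (Bracket s u))"
| Bracket_Scale_left: "lie_eq R (Bracket (Scale a s) t) (Scale a (Bracket s t))"
| Bracket_Scale_right: "lie_eq R (Bracket s (Scale a t)) (Scale a (Bracket s t))"
| Bracket_self: "lie_eq R (Bracket s s) Zero"
| Jacobi: "lie_eq R (Plus (Plus (Bracket s (Bracket t u)) (Bracket t (Bracket u s)))
                     (Bracket u (Bracket s t))) Zero"

lemma equivp_lie_eq: "equivp (lie_eq R)"
  by (intro equivpI reflpI sympI transpI) (auto intro: lie_eq.intros(2-4))

section \<open>The tetrahedron algebra\<close>

text \<open>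
  The index set \<open>{0,1,2,3}\<close> is the four-element type \<^typ>\<open>4\<close> (only its elements are used, not its
  arithmetic). There is one generator for each ordered pair of distinct indices.
\<close>

typedef tetra_gen = "{p :: 4 \<times> 4. fst p \<noteq> snd p}"
  by (rule exI[of _ "(0, 1)"]) simp

abbreviation X_term :: "4 \<Rightarrow> 4 \<Rightarrow> ('f, tetra_gen) lie_term" where
  "X_term i j \<equiv> Gen (Abs_tetra_gen (i, j))"

inductive tetra_rel ::
  "('f::field, tetra_gen) lie_term \<Rightarrow> ('f, tetra_gen) lie_term \<Rightarrow> bool" where
  antisym: "i \<noteq> j \<Longrightarrow> tetra_rel (Plus (X_term i j) (X_term j i)) Zero"
| triangle: "distinct [i, j, k] \<Longrightarrow>
    tetra_rel (Bracket (X_term i j) (X_term j k))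
              (Plus (Scale 2 (X_term i j)) (Scale 2 (X_term j k)))"
| dolan_grady: "distinct [h, i, j, k] \<Longrightarrow>
    tetra_rel (Bracket (X_term i j) (Bracket (X_term i j) (Bracket (X_term i j) (X_term k h))))
              (Scale 4 (Bracket (X_term i j) (X_term k h)))"

quotient_type (overloaded) 'f tetra =
  "('f::field, tetra_gen) lie_term" / "lie_eq tetra_rel"
  by (rule equivp_lie_eq)

instantiation tetra :: (field) ab_group_add
begin

lift_definition zero_tetra :: "'a tetra" is Zero .

lift_definition plus_tetra :: "'a tetra \<Rightarrow> 'a tetra \<Rightarrow> 'a tetra" is Plus
  by (rule lie_eq.Plus_cong)

lift_definition uminus_tetra :: "'a tetra \<Rightarrow> 'a tetra" is "Scale (-1)"
  by (rule lie_eq.Scale_cong)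

definition minus_tetra :: "'a tetra \<Rightarrow> 'a tetra \<Rightarrow> 'a tetra" where
  "minus_tetra x y = x + - y"

instance
proof
  fix a b c :: "'a tetra"
  show "a + b + c = a + (b + c)" by transfer (rule lie_eq.Plus_assoc)
  show "a + b = b + a" by transfer (rule lie_eq.Plus_comm)
  show "0 + a = a" by transfer (rule lie_eq.Plus_Zero)
  show "- a + a = 0" by transfer (rule lie_eq.Plus_neg)
  show "a - b = a + - b" by (rule minus_tetra_def)
qed

end

lift_definition tetra_scale :: "'f::field \<Rightarrow> 'f tetra \<Rightarrow> 'f tetra" is Scale
  by (rule lie_eq.Scale_cong)

lift_definition tetra_bracket :: "'f::field tetra \<Rightarrow> 'f tetra \<Rightarrow> 'f tetra" is Bracket
  by (rule lie_eq.Bracket_cong)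

interpretation tetra: lie_algebra tetra_scale tetra_bracket
proof
  fix a b :: "'f::field" and x y z :: "'f tetra"
  show "tetra_scale a (x + y) = tetra_scale a x + tetra_scale a y"
    by transfer (rule lie_eq.Scale_Plus)
  show "tetra_scale (a + b) x = tetra_scale a x + tetra_scale b x"
    by transfer (rule lie_eq.Scale_add)
  show "tetra_scale a (tetra_scale b x) = tetra_scale (a * b) x"
    by transfer (rule lie_eq.Scale_mult)
  show "tetra_scale 1 x = x"
    by transfer (rule lie_eq.Scale_one)
  show "tetra_bracket (x + y) z = tetra_bracket x z + tetra_bracket y z"
    by transfer (rule lie_eq.Bracket_Plus_left)
  show "tetra_bracket x (y + z) = tetra_bracket x y + tetra_bracket x z"
    by transfer (rule lie_eq.Bracket_Plus_right)
  show "tetra_bracket (tetra_scale a x) y = tetra_scale a (tetra_bracket x y)"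
    by transfer (rule lie_eq.Bracket_Scale_left)
  show "tetra_bracket x (tetra_scale a y) = tetra_scale a (tetra_bracket x y)"
    by transfer (rule lie_eq.Bracket_Scale_right)
  show "tetra_bracket x x = 0"
    by transfer (rule lie_eq.Bracket_self)
  show "tetra_bracket x (tetra_bracket y z) + tetra_bracket y (tetra_bracket z x)
          + tetra_bracket z (tetra_bracket x y) = 0"
    by transfer (rule lie_eq.Jacobi)
qed

text \<open>Only meaningful for distinct indices.\<close>

lift_definition tetra_x :: "4 \<Rightarrow> 4 \<Rightarrow> 'f::field tetra" is "\<lambda>i j. X_term i j" .

lemma tetra_x_antisym: "i \<noteq> j \<Longrightarrow> tetra_x i j + tetra_x j i = 0"
  by transfer (rule lie_eq.rel, rule tetra_rel.antisym)

lemma tetra_x_triangle: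
  "distinct [i, j, k] \<Longrightarrow>
    tetra_bracket (tetra_x i j) (tetra_x j k)
      = tetra_scale 2 (tetra_x i j) + tetra_scale 2 (tetra_x j k)"
  by transfer (rule lie_eq.rel, rule tetra_rel.triangle)

lemma tetra_x_dolan_grady:
  "distinct [h, i, j, k] \<Longrightarrow>
    tetra_bracket (tetra_x i j) (tetra_bracket (tetra_x i j)
        (tetra_bracket (tetra_x i j) (tetra_x k h)))
      = tetra_scale 4 (tetra_bracket (tetra_x i j) (tetra_x k h))"
  by transfer (rule lie_eq.rel, rule tetra_rel.dolan_grady)

definition x_like :: "4 \<Rightarrow> 4 \<Rightarrow> 'f::field tetra \<Rightarrow> bool" where
  "x_like i j \<xi> \<longleftrightarrow>
     tetra_bracket (tetra_x i j) \<xi> = 0 \<and>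
     (\<forall>h k. distinct [h, i, j, k] \<longrightarrow>
        tetra_bracket (tetra_x k h) (tetra_bracket (tetra_x k h) (tetra_bracket (tetra_x k h) \<xi>))
          = tetra_scale 4 (tetra_bracket (tetra_x k h) \<xi>))"

definition X_space :: "4 \<Rightarrow> 4 \<Rightarrow> 'f::field tetra set" where
  "X_space i j = {\<xi>. x_like i j \<xi>}"

section \<open>The Onsager algebra and its image in the tetrahedron algebra\<close>

datatype onsager_gen = Gen_A | Gen_B

inductive onsager_rel ::
  "('f::field, onsager_gen) lie_term \<Rightarrow> ('f, onsager_gen) lie_term \<Rightarrow> bool" where
  "onsager_rel (Bracket (Gen Gen_A) (Bracket (Gen Gen_A) (Bracket (Gen Gen_A) (Gen Gen_B))))
               (Scale 4 (Bracket (Gen Gen_A) (Gen Gen_B)))"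
| "onsager_rel (Bracket (Gen Gen_B) (Bracket (Gen Gen_B) (Bracket (Gen Gen_B) (Gen Gen_A))))
               (Scale 4 (Bracket (Gen Gen_B) (Gen Gen_A)))"

quotient_type (overloaded) 'f onsager =
  "('f::field, onsager_gen) lie_term" / "lie_eq onsager_rel"
  by (rule equivp_lie_eq)

instantiation onsager :: (field) ab_group_add
begin

lift_definition zero_onsager :: "'a onsager" is Zero .

lift_definition plus_onsager :: "'a onsager \<Rightarrow> 'a onsager \<Rightarrow> 'a onsager" is Plus
  by (rule lie_eq.Plus_cong)

lift_definition uminus_onsager :: "'a onsager \<Rightarrow> 'a onsager" is "Scale (-1)"
  by (rule lie_eq.Scale_cong)

definition minus_onsager :: "'a onsager \<Rightarrow> 'a onsager \<Rightarrow> 'a onsager" where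
  "minus_onsager x y = x + - y"

instance
proof
  fix a b c :: "'a onsager"
  show "a + b + c = a + (b + c)" by transfer (rule lie_eq.Plus_assoc)
  show "a + b = b + a" by transfer (rule lie_eq.Plus_comm)
  show "0 + a = a" by transfer (rule lie_eq.Plus_Zero)
  show "- a + a = 0" by transfer (rule lie_eq.Plus_neg)
  show "a - b = a + - b" by (rule minus_onsager_def)
qed

end

lift_definition onsager_scale :: "'f::field \<Rightarrow> 'f onsager \<Rightarrow> 'f onsager" is Scale
  by (rule lie_eq.Scale_cong)

lift_definition onsager_bracket :: "'f::field onsager \<Rightarrow> 'f onsager \<Rightarrow> 'f onsager" is Bracket
  by (rule lie_eq.Bracket_cong)

lift_definition onsager_A :: "'f::field onsager" is "Gen Gen_A" .

lift_definition onsager_B :: "'f::field onsager" is "Gen Gen_B" .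

interpretation onsager: lie_algebra onsager_scale onsager_bracket
proof
  fix a b :: "'f::field" and x y z :: "'f onsager"
  show "onsager_scale a (x + y) = onsager_scale a x + onsager_scale a y"
    by transfer (rule lie_eq.Scale_Plus)
  show "onsager_scale (a + b) x = onsager_scale a x + onsager_scale b x"
    by transfer (rule lie_eq.Scale_add)
  show "onsager_scale a (onsager_scale b x) = onsager_scale (a * b) x"
    by transfer (rule lie_eq.Scale_mult)
  show "onsager_scale 1 x = x"
    by transfer (rule lie_eq.Scale_one)
  show "onsager_bracket (x + y) z = onsager_bracket x z + onsager_bracket y z"
    by transfer (rule lie_eq.Bracket_Plus_left)
  show "onsager_bracket x (y + z) = onsager_bracket x y + onsager_bracket x z"
    by transfer (rule lie_eq.Bracket_Plus_right)
  show "onsager_bracket (onsager_scale a x) y = onsager_scale a (onsager_bracket x y)"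
    by transfer (rule lie_eq.Bracket_Scale_left)
  show "onsager_bracket x (onsager_scale a y) = onsager_scale a (onsager_bracket x y)"
    by transfer (rule lie_eq.Bracket_Scale_right)
  show "onsager_bracket x x = 0"
    by transfer (rule lie_eq.Bracket_self)
  show "onsager_bracket x (onsager_bracket y z) + onsager_bracket y (onsager_bracket z x)
          + onsager_bracket z (onsager_bracket x y) = 0"
    by transfer (rule lie_eq.Jacobi)
qed

primrec onsager_gen_image :: "onsager_gen \<Rightarrow> tetra_gen" where
  "onsager_gen_image Gen_A = Abs_tetra_gen (1, 2)"
| "onsager_gen_image Gen_B = Abs_tetra_gen (0, 3)"

lemma onsager_image_respects:
  assumes "lie_eq onsager_rel s t"
  shows "lie_eq tetra_rel (map_lie_term (\<lambda>a. a) onsager_gen_image s)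
                          (map_lie_term (\<lambda>a. a) onsager_gen_image t)"
  using assms
proof (induction rule: lie_eq.induct)
  case (rel s t)
  have "tetra_rel (map_lie_term (\<lambda>a. a) onsager_gen_image s)
                  (map_lie_term (\<lambda>a. a) onsager_gen_image t)"
    using rel
  proof cases
    case 1
    then show ?thesis
      using tetra_rel.dolan_grady[of 3 1 2 0] by simp
  next
    case 2
    then show ?thesis
      using tetra_rel.dolan_grady[of 2 0 3 1] by simp
  qed
  then show ?case by (rule lie_eq.rel)
qed (auto intro: lie_eq.intros(2-))

lift_definition onsager_to_tetra :: "'f::field onsager \<Rightarrow> 'f tetra"
  is "map_lie_term (\<lambda>a. a) onsager_gen_image"
  by (rule onsager_image_respects)

lemma onsager_to_tetra_simps:
  "onsager_to_tetra onsager_A = tetra_x 1 2"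
  "onsager_to_tetra onsager_B = tetra_x 0 3"
  "onsager_to_tetra 0 = 0"
  "onsager_to_tetra (x + y) = onsager_to_tetra x + onsager_to_tetra y"
  "onsager_to_tetra (onsager_scale a x) = tetra_scale a (onsager_to_tetra x)"
  "onsager_to_tetra (onsager_bracket x y)
     = tetra_bracket (onsager_to_tetra x) (onsager_to_tetra y)"
  by (transfer; simp add: lie_eq.refl)+

definition O_sub :: "'f::field tetra set" where
  "O_sub = range onsager_to_tetra"

lemma O_sub_eq_generated:
  "O_sub = tetra.lie_subalgebra hull {tetra_x 1 2, tetra_x 0 3}"
proof (rule hull_unique[symmetric])
  show "{tetra_x 1 2, tetra_x 0 3} \<subseteq> (O_sub :: 'a tetra set)"
    unfolding O_sub_def by (metis (no_types) onsager_to_tetra_simps(1,2) empty_subsetI insert_subset rangeI)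
  show "tetra.lie_subalgebra (O_sub :: 'a tetra set)"
    unfolding O_sub_def tetra.lie_subalgebra_def tetra.subspace_def
    by (auto simp flip: onsager_to_tetra_simps(3-6))
next
  fix S :: "'a tetra set"
  assume gens: "{tetra_x 1 2, tetra_x 0 3} \<subseteq> S" and S: "tetra.lie_subalgebra S"
  have "abs_tetra (map_lie_term (\<lambda>a. a) onsager_gen_image s) \<in> S" for s
  proof (induction s)
    case (Gen g)
    then show ?case using gens by (cases g) (auto simp: tetra_x.abs_eq)
  next
    case Zero
    then show ?case using S
      by (simp add: tetra.lie_subalgebra_def tetra.subspace_def flip: zero_tetra.abs_eq)
  qed (use S in \<open>auto simp: tetra.lie_subalgebra_def tetra.subspace_def
        simp flip: plus_tetra.abs_eq tetra_scale.abs_eq tetra_bracket.abs_eq\<close>)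
  then have "onsager_to_tetra x \<in> S" for x
    by (induction x rule: onsager.abs_induct) (simp add: onsager_to_tetra.abs_eq)
  then show "O_sub \<subseteq> S"
    unfolding O_sub_def by blast
qed

section \<open>Direct sums\<close>

definition direct_sum3 :: "'a::ab_group_add set \<Rightarrow> 'a set \<Rightarrow> 'a set \<Rightarrow> bool" where
  "direct_sum3 U V W \<longleftrightarrow> inj_on (\<lambda>(u, v, w). u + v + w) (U \<times> V \<times> W)"

end

theory Submission
  imports Defs "HOL-Computational_Algebra.Polynomial"
begin

text \<open>
  All four decompositions are instances of one statement for a path \<open>p - q - r - s\<close> through the index
  set: the subalgebra \<open>O\<close> generated by \<open>x = x\<^sub>r\<^sub>s\<close> and \<open>y = x\<^sub>p\<^sub>q\<close> is the direct sum of its intersections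
  with \<open>X\<^sub>p\<^sub>q\<close>, \<open>X\<^sub>q\<^sub>r\<close> and \<open>X\<^sub>r\<^sub>s\<close>. Put \<open>z = x\<^sub>q\<^sub>r\<close>. Then \<open>e = x + z\<close> and \<open>f = y + z\<close> are eigenvectors of
  \<open>ad z\<close>, and the Dolan-Grady relations become the Serre relations of the positive part of affine
  \<open>sl\<^sub>2\<close>, whose loop elements \<open>e t\<^sup>n\<close>, \<open>f t\<^sup>n\<close>, \<open>z t\<^sup>n\<close> multiply as expected. The elements \<open>x t\<^sup>n\<close>, \<open>y t\<^sup>n\<close>
  and \<open>z (t\<^sup>n - t\<^sup>n\<^sup>+\<^sup>1)\<close> span \<open>O\<close> and lie in the three subspaces; for the last family this
  uses that the path \<open>q - p - s - r\<close> gives the same \<open>O\<close> and expresses \<open>z (t\<^sup>n - t\<^sup>n\<^sup>+\<^sup>1)\<close>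
  as a sum of eigenvectors of \<open>ad x\<^sub>p\<^sub>s\<close>.

  For directness, four distinct points \<open>a\<^sub>i\<close> of the affine line give a representation of the tetrahedron
  algebra by quadratic vector fields, \<open>x\<^sub>i\<^sub>j\<close> going to a multiple of \<open>(u - a\<^sub>i) (u - a\<^sub>j)\<close>, in which \<open>t\<close> acts as
  a cross-ratio. A field commuting with \<open>x\<^sub>i\<^sub>j\<close> vanishes at \<open>a\<^sub>i\<close> and \<open>a\<^sub>j\<close>, so the three summands are
  independent in every such representation; as the cross-ratio takes infinitely many values, these
  representations are jointly faithful on \<open>O\<close>.
\<close>

section \<open>Linear functionals and brackets\<close>

text \<open>A nonzero \<open>v - w\<close> is independent, so some functional takes the value 1 on
  it. Vector identities thereby reduce to polynomial identities in the field.\<close>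

lemma (in vector_space) eq_by_functionals:
  assumes "\<And>g. Vector_Spaces.linear scale (*) g \<Longrightarrow> g v = g w"
  shows "v = w"
proof (rule ccontr)
  assume "v \<noteq> w"
  interpret field_space: vector_space "(*) :: 'a \<Rightarrow> 'a \<Rightarrow> 'a"
    by standard (simp_all add: algebra_simps)
  interpret vector_space_pair scale "(*) :: 'a \<Rightarrow> 'a \<Rightarrow> 'a" ..
  have "independent {v - w}"
    using \<open>v \<noteq> w\<close> by simp
  then obtain g where g: "Vector_Spaces.linear scale (*) g" "g (v - w) = 1"
    using linear_independent_extend[of "{v - w}" "\<lambda>_. 1"] by auto
  then show False
    using assms[OF g(1)] linear_diff[OF g(1)] by simp
qed

lemma linear_functional_simps:
  assumes "Vector_Spaces.linear s (*) g"
  shows "g (x + y) = g x + g y" "g (x - y) = g x - g y" "g (- x) = - g x" "g 0 = 0"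
    "g (s a x) = a * g x"
proof -
  interpret Vector_Spaces.linear s "(*)" g by fact
  show "g (x + y) = g x + g y" "g (x - y) = g x - g y" "g (- x) = - g x" "g 0 = 0"
    "g (s a x) = a * g x"
    by (rule add diff neg zero scale)+
qed

locale lie_algebra_char_0 = lie_algebra scale bracket
  for scale :: "'f::field_char_0 \<Rightarrow> 'a::ab_group_add \<Rightarrow> 'a"
    and bracket :: "'a \<Rightarrow> 'a \<Rightarrow> 'a"
begin

notation scale (infixr "*s" 75)
notation bracket ("\<lbrakk>_,/ _\<rbrakk>")

lemma bracket_zero_left [simp]: "\<lbrakk>0, x\<rbrakk> = 0"
  using bracket_add_left[of 0 0 x] by simp

lemma bracket_zero_right [simp]: "\<lbrakk>x, 0\<rbrakk> = 0"
  using bracket_add_right[of x 0 0] by simp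

lemma bracket_minus_left: "\<lbrakk>- x, y\<rbrakk> = - \<lbrakk>x, y\<rbrakk>"
  using bracket_add_left[of "- x" x y] by (simp add: eq_neg_iff_add_eq_0)

lemma bracket_minus_right: "\<lbrakk>x, - y\<rbrakk> = - \<lbrakk>x, y\<rbrakk>"
  using bracket_add_right[of x "- y" y] by (simp add: eq_neg_iff_add_eq_0)

lemma bracket_diff_left: "\<lbrakk>x - y, w\<rbrakk> = \<lbrakk>x, w\<rbrakk> - \<lbrakk>y, w\<rbrakk>"
  using bracket_add_left[of x "- y" w] by (simp add: bracket_minus_left)

lemma bracket_diff_right: "\<lbrakk>w, x - y\<rbrakk> = \<lbrakk>w, x\<rbrakk> - \<lbrakk>w, y\<rbrakk>"
  using bracket_add_right[of w x "- y"] by (simp add: bracket_minus_right)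

lemmas bracket_linear = bracket_add_left bracket_add_right bracket_scale_left bracket_scale_right
  bracket_minus_left bracket_minus_right bracket_diff_left bracket_diff_right

lemma bracket_anticomm: "\<lbrakk>x, y\<rbrakk> = - \<lbrakk>y, x\<rbrakk>"
proof -
  have "\<lbrakk>x + y, x + y\<rbrakk> = (\<lbrakk>x, x\<rbrakk> + \<lbrakk>y, x\<rbrakk>) + (\<lbrakk>x, y\<rbrakk> + \<lbrakk>y, y\<rbrakk>)"
    by (simp only: bracket_add_left bracket_add_right)
  then show ?thesis
    by (simp add: bracket_self eq_neg_iff_add_eq_0 add.commute)
qed

lemma bracket_derivation: "\<lbrakk>x, \<lbrakk>y, w\<rbrakk>\<rbrakk> = \<lbrakk>\<lbrakk>x, y\<rbrakk>, w\<rbrakk> + \<lbrakk>y, \<lbrakk>x, w\<rbrakk>\<rbrakk>"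
proof -
  have "\<lbrakk>y, \<lbrakk>w, x\<rbrakk>\<rbrakk> = - \<lbrakk>y, \<lbrakk>x, w\<rbrakk>\<rbrakk>" "\<lbrakk>w, \<lbrakk>x, y\<rbrakk>\<rbrakk> = - \<lbrakk>\<lbrakk>x, y\<rbrakk>, w\<rbrakk>"
    by (metis bracket_anticomm bracket_minus_right) (rule bracket_anticomm)
  then show ?thesis
    using jacobi[of x y w] by (simp add: algebra_simps)
qed

text \<open>Up to the factor \<open>c\<close>, \<open>d1\<close> and \<open>d2\<close> act like
  multiplication by \<open>t\<close> and \<open>t^2\<close>. In each total degree, two uses of
  \<open>d1\<close> give \<open>[a (i+2), a j] = [a i, a (j+2)]\<close>, while \<open>d2\<close>
  gives the same with the opposite sign, so twice the bracket vanishes.\<close>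

lemma commuting_sequence:
  assumes "c \<noteq> 0"
    and d1: "\<And>n. \<lbrakk>d1, a n\<rbrakk> = c *s a (Suc n)"
    and d2: "\<And>n. \<lbrakk>d2, a n\<rbrakk> = c *s a (Suc (Suc n))"
    and "\<lbrakk>a 0, a 1\<rbrakk> = 0"
  shows "\<lbrakk>a i, a j\<rbrakk> = 0"
proof -
  have step1: "\<lbrakk>a (Suc i), a j\<rbrakk> = - \<lbrakk>a i, a (Suc j)\<rbrakk>" if "\<lbrakk>a i, a j\<rbrakk> = 0" for i j
  proof -
    have "c *s (\<lbrakk>a (Suc i), a j\<rbrakk> + \<lbrakk>a i, a (Suc j)\<rbrakk>) = 0"
      using bracket_derivation[of d1 "a i" "a j"] that
      by (simp add: d1 bracket_linear scale_right_distrib)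
    then show ?thesis
      using \<open>c \<noteq> 0\<close> by (simp add: eq_neg_iff_add_eq_0)
  qed
  have step2: "\<lbrakk>a (Suc (Suc i)), a j\<rbrakk> = - \<lbrakk>a i, a (Suc (Suc j))\<rbrakk>" if "\<lbrakk>a i, a j\<rbrakk> = 0" for i j
  proof -
    have "c *s (\<lbrakk>a (Suc (Suc i)), a j\<rbrakk> + \<lbrakk>a i, a (Suc (Suc j))\<rbrakk>) = 0"
      using bracket_derivation[of d2 "a i" "a j"] that
      by (simp add: d2 bracket_linear scale_right_distrib)
    then show ?thesis
      using \<open>c \<noteq> 0\<close> by (simp add: eq_neg_iff_add_eq_0)
  qed
  have "\<forall>i j. i + j = n \<longrightarrow> \<lbrakk>a i, a j\<rbrakk> = 0" for n
  proof (induction n rule: less_induct)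
    case (less n)
    consider "n = 0" | "n = 1" | m where "n = Suc (Suc m)"
      by (metis One_nat_def not0_implies_Suc)
    then show ?case
    proof cases
      case 1
      then show ?thesis by (simp add: bracket_self)
    next
      case 2
      have "\<lbrakk>a 1, a 0\<rbrakk> = 0"
        using bracket_anticomm[of "a 1" "a 0"] assms(4) by simp
      moreover have "i = 0 \<and> j = 1 \<or> i = 1 \<and> j = 0" if "i + j = n" for i j
        using that 2 by auto
      ultimately show ?thesis using assms(4) by blast
    next
      case 3
      have zero: "\<lbrakk>a i, a (Suc (Suc j))\<rbrakk> = 0 \<and> \<lbrakk>a (Suc i), a (Suc j)\<rbrakk> = 0 \<and> \<lbrakk>a (Suc (Suc i)), a j\<rbrakk> = 0"
        if "i + j = m" for i j
      proof -
        have "\<lbrakk>a i, a j\<rbrakk> = 0" "\<lbrakk>a (Suc i), a j\<rbrakk> = 0" "\<lbrakk>a i, a (Suc j)\<rbrakk> = 0"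
          by (rule less.IH[rule_format, OF _ HOL.refl]; use that 3 in simp)+
        then have h: "\<lbrakk>a (Suc (Suc i)), a j\<rbrakk> = - \<lbrakk>a i, a (Suc (Suc j))\<rbrakk>"
          "\<lbrakk>a (Suc (Suc i)), a j\<rbrakk> = - \<lbrakk>a (Suc i), a (Suc j)\<rbrakk>"
          "\<lbrakk>a (Suc i), a (Suc j)\<rbrakk> = - \<lbrakk>a i, a (Suc (Suc j))\<rbrakk>"
          using step1 step2 by blast+
        then have "(2::'f) *s \<lbrakk>a i, a (Suc (Suc j))\<rbrakk> = 0"
          by (metis add.inverse_inverse add.left_inverse scale_left_distrib scale_one one_add_one)
        then show ?thesis
          using h by simp
      qed
      show ?thesis
      proof (intro allI impI)
        fix i j assume ij: "i + j = n"
        consider j' where "j = Suc (Suc j')" | "j = 1" | "j = 0"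
          by (metis One_nat_def not0_implies_Suc)
        then show "\<lbrakk>a i, a j\<rbrakk> = 0"
        proof cases
          case 1
          then show ?thesis using zero[of i j'] ij 3 by simp
        next
          case 2
          then show ?thesis using zero[of m 0] ij 3 by simp
        next
          case j: 3
          then show ?thesis using zero[of m 0] ij 3 by simp
        qed
      qed
    qed
  qed
  then show ?thesis by blast
qed

end

section \<open>The positive part of affine sl2\<close>

locale serre_pair = lie_algebra_char_0 scale bracket
  for scale :: "'f::field_char_0 \<Rightarrow> 'a::ab_group_add \<Rightarrow> 'a" (infixr "*s" 75)
    and bracket :: "'a \<Rightarrow> 'a \<Rightarrow> 'a" ("\<lbrakk>_,/ _\<rbrakk>") +
  fixes e f z :: 'a
  assumes weight_e: "\<lbrakk>z, e\<rbrakk> = 2 *s e"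
    and weight_f: "\<lbrakk>z, f\<rbrakk> = (-2) *s f"
    and serre_e: "\<lbrakk>e, \<lbrakk>e, \<lbrakk>e, f\<rbrakk>\<rbrakk>\<rbrakk> = 0"
    and serre_f: "\<lbrakk>f, \<lbrakk>f, \<lbrakk>f, e\<rbrakk>\<rbrakk>\<rbrakk> = 0"
begin

text \<open>In the loop algebra \<open>z1\<close>, \<open>ee n\<close>, \<open>ff n\<close>, \<open>zz n\<close> are \<open>z t\<close>, \<open>e t\<^sup>n\<close>, \<open>f t\<^sup>n\<close>, \<open>z t\<^sup>n\<close>, normalized by \<open>[e, f] = - 4 z t\<close>.\<close>

definition z1 :: 'a where
  "z1 = (- 1 / 4) *s \<lbrakk>e, f\<rbrakk>"

primrec ee :: "nat \<Rightarrow> 'a" where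
  "ee 0 = e"
| "ee (Suc n) = (1 / 2) *s \<lbrakk>z1, ee n\<rbrakk>"

primrec ff :: "nat \<Rightarrow> 'a" where
  "ff 0 = f"
| "ff (Suc n) = (- 1 / 2) *s \<lbrakk>z1, ff n\<rbrakk>"

primrec zz :: "nat \<Rightarrow> 'a" where
  "zz 0 = z"
| "zz (Suc n) = (- 1 / 4) *s \<lbrakk>ee n, f\<rbrakk>"

lemma zz_1: "zz (Suc 0) = z1"
  by (simp add: z1_def)

lemma bracket_e_f: "\<lbrakk>e, f\<rbrakk> = (-4) *s z1"
  by (simp add: z1_def)

lemma bracket_ee_f: "\<lbrakk>ee n, f\<rbrakk> = (-4) *s zz (Suc n)"
  by simp

lemma bracket_z1_ee: "\<lbrakk>z1, ee n\<rbrakk> = 2 *s ee (Suc n)"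
  by simp

lemma bracket_z1_ff: "\<lbrakk>z1, ff n\<rbrakk> = (-2) *s ff (Suc n)"
  by simp

declare ee.simps(2) [simp del] ff.simps(2) [simp del] zz.simps(2) [simp del]

lemma bracket_z_z1: "\<lbrakk>z, z1\<rbrakk> = 0"
  using bracket_derivation[of z e f]
  by (simp add: z1_def bracket_linear weight_e weight_f)

lemma bracket_z_ee: "\<lbrakk>z, ee n\<rbrakk> = 2 *s ee n"
proof (induction n)
  case (Suc n)
  then show ?case
    using bracket_derivation[of z z1 "ee n"]
    by (simp add: ee.simps(2) bracket_linear bracket_z_z1 mult.commute)
qed (simp add: weight_e)

lemma bracket_z_ff: "\<lbrakk>z, ff n\<rbrakk> = (-2) *s ff n"
proof (induction n)
  case (Suc n)
  then show ?case
    using bracket_derivation[of z z1 "ff n"]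
    by (simp add: ff.simps(2) bracket_linear bracket_z_z1 mult.commute)
qed (simp add: weight_f)

lemma bracket_z_zz: "\<lbrakk>z, zz n\<rbrakk> = 0"
proof (cases n)
  case (Suc m)
  then show ?thesis
    using bracket_derivation[of z "ee m" f]
    by (simp add: zz.simps(2) bracket_linear weight_f bracket_z_ee)
qed (simp add: bracket_self)

text \<open>This is the Serre relation for \<open>e\<close>: \<open>[e, f]\<close> is a multiple of
  \<open>z1\<close>, and \<open>[e, z1]\<close> is a multiple of \<open>ee 1\<close>.\<close>

lemma bracket_ee_01: "\<lbrakk>ee 0, ee 1\<rbrakk> = 0"
  using serre_e bracket_anticomm[of e z1] by (simp add: bracket_e_f ee.simps(2) bracket_linear)

lemma bracket_ff_01: "\<lbrakk>ff 0, ff 1\<rbrakk> = 0"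
  using serre_f bracket_anticomm[of f e] bracket_anticomm[of f z1]
  by (simp add: bracket_e_f ff.simps(2) bracket_linear)

text \<open>When \<open>ee n\<close> commutes with \<open>e\<close>, bracketing
  \<open>[ee n, f]\<close> with \<open>e\<close> leaves only \<open>[ee n, [e, f]]\<close>. Assuming
  this for a single \<open>n\<close> allows use before commutativity is known in general.\<close>

lemma bracket_zz_e:
  assumes "\<lbrakk>ee n, e\<rbrakk> = 0"
  shows "\<lbrakk>zz (Suc n), e\<rbrakk> = 2 *s ee (Suc n)"
proof -
  have "\<lbrakk>e, \<lbrakk>ee n, f\<rbrakk>\<rbrakk> = (-4) *s \<lbrakk>ee n, z1\<rbrakk>"
    using bracket_derivation[of e "ee n" f] bracket_anticomm[of e "ee n"] assms
    by (simp add: bracket_e_f bracket_linear)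
  then show ?thesis
    using bracket_anticomm[of "zz (Suc n)" e] bracket_anticomm[of "ee n" z1]
    by (simp add: zz.simps(2) bracket_linear bracket_z1_ee)
qed

text \<open>\<open>zz\<close> is defined through \<open>ee n\<close> and \<open>f\<close>; the
  second hypothesis supplies the mirror form through \<open>e\<close> and
  \<open>ff n\<close>.\<close>

lemma bracket_zz_f:
  assumes "\<lbrakk>ff n, f\<rbrakk> = 0" and "\<lbrakk>e, ff n\<rbrakk> = (-4) *s zz (Suc n)"
  shows "\<lbrakk>zz (Suc n), f\<rbrakk> = (-2) *s ff (Suc n)"
proof -
  have "\<lbrakk>f, \<lbrakk>e, ff n\<rbrakk>\<rbrakk> = 4 *s \<lbrakk>z1, ff n\<rbrakk>"
    using bracket_derivation[of f e "ff n"] bracket_anticomm[of f "ff n"] bracket_anticomm[of f e] assms(1)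
    by (simp add: bracket_e_f bracket_linear)
  then have "4 *s \<lbrakk>zz (Suc n), f\<rbrakk> = 4 *s \<lbrakk>z1, ff n\<rbrakk>"
    using bracket_anticomm[of "zz (Suc n)" f] by (simp add: assms(2) bracket_linear)
  then have "\<lbrakk>zz (Suc n), f\<rbrakk> = \<lbrakk>z1, ff n\<rbrakk>"
    by simp
  then show ?thesis
    by (simp add: bracket_z1_ff)
qed

text \<open>
  Summing the derivation rule for \<open>z1\<close> over \<open>i + j = n\<close> and expanding \<open>[zz (Suc n), [e, f]]\<close> give
  \<open>(n + 2) [z1, zz (Suc n)] = 0\<close>.
\<close>

lemma bracket_ee_ff_step:
  assumes ee: "\<lbrakk>ee n, e\<rbrakk> = 0" and ff: "\<lbrakk>ff n, f\<rbrakk> = 0"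
    and ef: "\<And>i j. i + j = n \<Longrightarrow> \<lbrakk>ee i, ff j\<rbrakk> = (-4) *s zz (Suc n)"
  shows "\<lbrakk>z1, zz (Suc n)\<rbrakk> = 0"
    and "i + j = Suc n \<Longrightarrow> \<lbrakk>ee i, ff j\<rbrakk> = (-4) *s zz (Suc (Suc n))"
proof -
  define d where "d = \<lbrakk>z1, zz (Suc n)\<rbrakk>"
  have diff: "\<lbrakk>ee (Suc i), ff j\<rbrakk> = \<lbrakk>ee i, ff (Suc j)\<rbrakk> + (-2) *s d" if "i + j = n" for i j
  proof (rule eq_by_functionals)
    fix g :: "'a \<Rightarrow> 'f" assume g: "Vector_Spaces.linear (*s) (*) g"
    have "(-4) *s d = 2 *s \<lbrakk>ee (Suc i), ff j\<rbrakk> + (-2) *s \<lbrakk>ee i, ff (Suc j)\<rbrakk>"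
      using bracket_derivation[of z1 "ee i" "ff j"]
      by (simp add: ef[OF that] d_def bracket_linear bracket_z1_ee bracket_z1_ff)
    from arg_cong[OF this, of g] show "g \<lbrakk>ee (Suc i), ff j\<rbrakk> = g (\<lbrakk>ee i, ff (Suc j)\<rbrakk> + (-2) *s d)"
      unfolding linear_functional_simps[OF g] by algebra
  qed
  \<comment> \<open>Telescoping \<open>diff\<close>: each shift of one index from \<open>ff\<close>
    to \<open>ee\<close> adds \<open>-2 d\<close>.\<close>
  have sum: "\<lbrakk>ee k, ff (Suc n - k)\<rbrakk> = \<lbrakk>e, ff (Suc n)\<rbrakk> + (-2 * of_nat k) *s d" if "k \<le> Suc n" for k
    using that
  proof (induction k)
    case (Suc k)
    then have "\<lbrakk>ee (Suc k), ff (n - k)\<rbrakk> = \<lbrakk>e, ff (Suc n)\<rbrakk> + ((-2 * of_nat k) *s d + (-2) *s d)"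
      using diff[of k "n - k"] by (simp add: Suc_diff_le add.assoc)
    also have "(-2 * of_nat k) *s d + (-2) *s d = (-2 * of_nat (Suc k)) *s d"
      by (simp only: scale_left_distrib[symmetric]) (simp add: algebra_simps)
    finally show ?case
      by (simp only: diff_Suc_Suc)
  qed simp
  \<comment> \<open>A second relation between the two end terms \<open>[ee (Suc n), f]\<close> and
    \<open>[e, ff (Suc n)]\<close>, independent of the telescoped one.\<close>
  have "\<lbrakk>zz (Suc n), \<lbrakk>e, f\<rbrakk>\<rbrakk> = 2 *s \<lbrakk>ee (Suc n), f\<rbrakk> + (-2) *s \<lbrakk>e, ff (Suc n)\<rbrakk>"
    using bracket_derivation[of "zz (Suc n)" e f] bracket_zz_e[OF ee] bracket_zz_f[OF ff] ef[of 0 n]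
    by (simp add: bracket_linear)
  moreover have "\<lbrakk>zz (Suc n), \<lbrakk>e, f\<rbrakk>\<rbrakk> = 4 *s d"
    using bracket_anticomm[of "zz (Suc n)" z1] by (simp add: d_def bracket_e_f bracket_linear)
  moreover have "\<lbrakk>ee (Suc n), f\<rbrakk> = \<lbrakk>e, ff (Suc n)\<rbrakk> + (-2 * of_nat (Suc n)) *s d"
    using sum[of "Suc n"] by simp
  ultimately have eq: "4 *s d = 2 *s (\<lbrakk>e, ff (Suc n)\<rbrakk> + (-2 * of_nat (Suc n)) *s d) + (-2) *s \<lbrakk>e, ff (Suc n)\<rbrakk>"
    by simp
  have "of_nat (n + 2) *s d = 0"
  proof (rule eq_by_functionals)
    fix g :: "'a \<Rightarrow> 'f" assume g: "Vector_Spaces.linear (*s) (*) g"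
    from arg_cong[OF eq, of g] show "g (of_nat (n + 2) *s d) = g 0"
      unfolding linear_functional_simps[OF g] of_nat_Suc of_nat_add of_nat_numeral by algebra
  qed
  moreover have "of_nat (n + 2) \<noteq> (0 :: 'f)"
    by (simp del: of_nat_add of_nat_Suc)
  ultimately have d: "d = 0"
    using scale_eq_0_iff by blast
  then show "\<lbrakk>z1, zz (Suc n)\<rbrakk> = 0"
    by (simp add: d_def)
  show "\<lbrakk>ee i, ff j\<rbrakk> = (-4) *s zz (Suc (Suc n))" if "i + j = Suc n"
  proof -
    have i: "i \<le> Suc n" and j: "j = Suc n - i"
      using that by simp_all
    have "\<lbrakk>ee i, ff j\<rbrakk> = \<lbrakk>e, ff (Suc n)\<rbrakk>" using sum[OF i] d j by simp
    also have "\<dots> = \<lbrakk>ee (Suc n), f\<rbrakk>" using sum[of "Suc n"] d by simp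
    finally show ?thesis by (simp add: bracket_ee_f)
  qed
qed

text \<open>Levels 0 and 1 of the preceding step rest on the Serre relations alone. They make
  \<open>zz 2\<close> commute with \<open>z1\<close>, so its action on \<open>e\<close> and
  \<open>f\<close> spreads to all \<open>ee n\<close> and \<open>ff n\<close>; it becomes the second
  operator for \<open>commuting_sequence\<close>.\<close>

lemma bracket_zz2_ee: "\<lbrakk>zz (Suc (Suc 0)), ee n\<rbrakk> = 2 *s ee (Suc (Suc n))"
  and bracket_zz2_ff: "\<lbrakk>zz (Suc (Suc 0)), ff n\<rbrakk> = (-2) *s ff (Suc (Suc n))"
proof -
  let ?z2 = "zz (Suc (Suc 0))"
  have ee: "\<lbrakk>ee (Suc 0), e\<rbrakk> = 0" and ff: "\<lbrakk>ff (Suc 0), f\<rbrakk> = 0"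
    using bracket_ee_01 bracket_ff_01 bracket_anticomm[of "ee 1" "ee 0"] bracket_anticomm[of "ff 1" "ff 0"]
    by simp_all
  have ef: "\<lbrakk>ee i, ff j\<rbrakk> = (-4) *s ?z2" if "i + j = Suc 0" for i j
    by (rule bracket_ee_ff_step(2)[of 0]) (use that in \<open>simp_all add: bracket_self bracket_e_f zz_1\<close>)
  have D: "\<lbrakk>z1, ?z2\<rbrakk> = 0"
    by (rule bracket_ee_ff_step(1)[OF ee ff ef])
  then have D': "\<lbrakk>?z2, z1\<rbrakk> = 0"
    using bracket_anticomm[of ?z2 z1] by simp
  show "\<lbrakk>?z2, ee n\<rbrakk> = 2 *s ee (Suc (Suc n))"
  proof (induction n)
    case 0
    then show ?case using bracket_zz_e[OF ee] by simp
  next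
    case (Suc n)
    then show ?case
      using bracket_derivation[of ?z2 z1 "ee n"] D'
      by (simp add: ee.simps(2) bracket_linear)
  qed
  show "\<lbrakk>?z2, ff n\<rbrakk> = (-2) *s ff (Suc (Suc n))"
  proof (induction n)
    case 0
    then show ?case using bracket_zz_f[OF ff] ef[of 0 1] by simp
  next
    case (Suc n)
    then show ?case
      using bracket_derivation[of ?z2 z1 "ff n"] D'
      by (simp add: ff.simps(2) bracket_linear)
  qed
qed

lemma bracket_ee_ee: "\<lbrakk>ee i, ee j\<rbrakk> = 0"
  by (rule commuting_sequence[of 2 z1 _ "zz (Suc (Suc 0))"])
    (simp_all add: bracket_z1_ee bracket_zz2_ee bracket_ee_01[simplified])

lemma bracket_ff_ff: "\<lbrakk>ff i, ff j\<rbrakk> = 0"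
  by (rule commuting_sequence[of "-2" z1 _ "zz (Suc (Suc 0))"])
    (simp_all add: bracket_z1_ff bracket_zz2_ff bracket_ff_01[simplified])

lemma bracket_ee_ff: "\<lbrakk>ee i, ff j\<rbrakk> = (-4) *s zz (Suc (i + j))"
proof -
  have "i + j = n \<Longrightarrow> \<lbrakk>ee i, ff j\<rbrakk> = (-4) *s zz (Suc n)" for n
  proof (induction n arbitrary: i j)
    case 0
    then show ?case by (simp add: bracket_e_f zz_1)
  next
    case (Suc n)
    then show ?case
      using bracket_ee_ff_step(2)[of n i j] bracket_ee_ee[of n 0] bracket_ff_ff[of n 0] by simp
  qed
  then show ?thesis by blast
qed

lemma bracket_e_zz: "\<lbrakk>e, zz n\<rbrakk> = (-2) *s ee n"
proof (cases n)
  case 0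
  then show ?thesis using bracket_anticomm[of e z] by (simp add: weight_e)
next
  case (Suc m)
  then show ?thesis
    using bracket_zz_e[of m] bracket_ee_ee[of m 0] bracket_anticomm[of e "zz n"] by simp
qed

lemma bracket_f_zz: "\<lbrakk>f, zz n\<rbrakk> = 2 *s ff n"
proof (cases n)
  case 0
  then show ?thesis using bracket_anticomm[of f z] by (simp add: weight_f)
next
  case (Suc m)
  then show ?thesis
    using bracket_zz_f[of m] bracket_ff_ff[of m 0] bracket_ee_ff[of 0 m] bracket_anticomm[of f "zz n"] by simp
qed

end

section \<open>The subalgebra attached to a path\<close>

locale onsager_path = lie_algebra_char_0 scale bracket
  for scale :: "'f::field_char_0 \<Rightarrow> 'a::ab_group_add \<Rightarrow> 'a" (infixr "*s" 75)
    and bracket :: "'a \<Rightarrow> 'a \<Rightarrow> 'a" ("\<lbrakk>_,/ _\<rbrakk>") +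
  fixes x y z :: 'a
  assumes bracket_z_x: "\<lbrakk>z, x\<rbrakk> = 2 *s z + 2 *s x"
    and bracket_y_z: "\<lbrakk>y, z\<rbrakk> = 2 *s y + 2 *s z"
    and dolan_grady_x: "\<lbrakk>x, \<lbrakk>x, \<lbrakk>x, y\<rbrakk>\<rbrakk>\<rbrakk> = 4 *s \<lbrakk>x, y\<rbrakk>"
    and dolan_grady_y: "\<lbrakk>y, \<lbrakk>y, \<lbrakk>y, x\<rbrakk>\<rbrakk>\<rbrakk> = 4 *s \<lbrakk>y, x\<rbrakk>"
begin

lemma weight_x_plus_z: "\<lbrakk>z, x + z\<rbrakk> = 2 *s (x + z)"
  by (simp add: bracket_linear bracket_self bracket_z_x scale_right_distrib add.commute)

lemma weight_y_plus_z: "\<lbrakk>z, y + z\<rbrakk> = (-2) *s (y + z)"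
  using bracket_anticomm[of z y]
  by (simp add: bracket_linear bracket_self bracket_y_z scale_right_distrib add.commute)

text \<open>Under \<open>ad z\<close> the elements \<open>a\<close> and \<open>b\<close> have
  eigenvalues 0 and 2, so on them \<open>ad (x + z)\<close> is \<open>ad x\<close> plus 0 or 2. The
  claim becomes \<open>[x, [x, a]] + 2 [x, a] = 0\<close>, where the Dolan-Grady relation removes
  the cubic term.\<close>

lemma ad_x_plus_z_cube: "\<lbrakk>x + z, \<lbrakk>x + z, \<lbrakk>x + z, y + z\<rbrakk>\<rbrakk>\<rbrakk> = 0"
proof -
  define a where "a = \<lbrakk>x + z, y + z\<rbrakk>"
  define b where "b = \<lbrakk>x + z, a\<rbrakk>"
  have xz: "\<lbrakk>x, z\<rbrakk> = - (2 *s z + 2 *s x)" and zy: "\<lbrakk>z, y\<rbrakk> = - (2 *s y + 2 *s z)"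
    using bracket_anticomm[of x z] bracket_anticomm[of z y] by (simp_all add: bracket_z_x bracket_y_z)
  have za: "\<lbrakk>z, a\<rbrakk> = 0"
    using bracket_derivation[of z "x + z" "y + z"]
    by (simp only: a_def weight_x_plus_z weight_y_plus_z bracket_scale_left bracket_scale_right)
      (simp flip: scale_left_distrib)
  have zb: "\<lbrakk>z, b\<rbrakk> = 2 *s b"
    using bracket_derivation[of z "x + z" a] za
    by (simp only: b_def weight_x_plus_z bracket_scale_left) simp
  have a: "a = \<lbrakk>x, y\<rbrakk> - (2 *s z + 2 *s x) - (2 *s y + 2 *s z)"
    by (simp add: a_def bracket_linear bracket_self xz zy algebra_simps)
  have b: "b = \<lbrakk>x, a\<rbrakk>"
    by (simp add: b_def bracket_add_left za)
  have xa: "\<lbrakk>x, a\<rbrakk> = \<lbrakk>x, \<lbrakk>x, y\<rbrakk>\<rbrakk> - 2 *s \<lbrakk>x, z\<rbrakk> - (2 *s \<lbrakk>x, y\<rbrakk> + 2 *s \<lbrakk>x, z\<rbrakk>)"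
    by (simp add: a bracket_linear bracket_self)
  have xb: "\<lbrakk>x, b\<rbrakk> = 4 *s \<lbrakk>x, y\<rbrakk> - 2 *s \<lbrakk>x, \<lbrakk>x, z\<rbrakk>\<rbrakk> - (2 *s \<lbrakk>x, \<lbrakk>x, y\<rbrakk>\<rbrakk> + 2 *s \<lbrakk>x, \<lbrakk>x, z\<rbrakk>\<rbrakk>)"
    by (simp add: b xa bracket_linear dolan_grady_x)
  have xxz: "\<lbrakk>x, \<lbrakk>x, z\<rbrakk>\<rbrakk> = - (2 *s \<lbrakk>x, z\<rbrakk>)"
    by (simp add: xz bracket_linear bracket_self)
  have "\<lbrakk>x + z, b\<rbrakk> = \<lbrakk>x, b\<rbrakk> + 2 *s b"
    by (simp add: bracket_add_left zb)
  also have "\<dots> = 0"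
  proof (rule eq_by_functionals)
    fix g :: "'a \<Rightarrow> 'f" assume g: "Vector_Spaces.linear (*s) (*) g"
    show "g (\<lbrakk>x, b\<rbrakk> + 2 *s b) = g 0"
      unfolding xb xxz unfolding b xa linear_functional_simps[OF g] by algebra
  qed
  finally show ?thesis
    by (simp only: b_def a_def)
qed

text \<open>Walking the path backwards swaps \<open>e\<close> and \<open>f\<close> up to sign, so
  the Serre relation for \<open>f\<close> follows from the one for \<open>e\<close>.\<close>

lemma reversed_path: "onsager_path (*s) bracket (- y) (- x) (- z)"
proof
  show "\<lbrakk>- z, - y\<rbrakk> = 2 *s (- z) + 2 *s (- y)" "\<lbrakk>- x, - z\<rbrakk> = 2 *s (- x) + 2 *s (- z)"
    using bracket_anticomm[of z y] bracket_anticomm[of x z]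
    by (simp_all add: bracket_linear bracket_z_x bracket_y_z)
qed (simp_all add: bracket_linear dolan_grady_x dolan_grady_y)

sublocale serre_pair "(*s)" bracket "x + z" "y + z" z
proof
  have "- y + - z = - (y + z)" "- x + - z = - (x + z)"
    by simp_all
  then show "\<lbrakk>y + z, \<lbrakk>y + z, \<lbrakk>y + z, x + z\<rbrakk>\<rbrakk>\<rbrakk> = 0"
    using onsager_path.ad_x_plus_z_cube[OF reversed_path]
    by (simp only: bracket_minus_left bracket_minus_right minus_minus)
qed (fact weight_x_plus_z weight_y_plus_z ad_x_plus_z_cube)+

section \<open>The three spanning families and their brackets with the path elements\<close>

definition XX :: "nat \<Rightarrow> 'a" where "XX n = ee n - zz n"
definition YY :: "nat \<Rightarrow> 'a" where "YY n = ff n - zz n"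
definition WW :: "nat \<Rightarrow> 'a" where "WW n = zz n - zz (Suc n)"

lemma XX_0: "XX 0 = x" and YY_0: "YY 0 = y"
  by (simp_all add: XX_def YY_def)

lemma bracket_x_ee: "\<lbrakk>x, ee n\<rbrakk> = (-2) *s ee n"
  and bracket_x_ff: "\<lbrakk>x, ff n\<rbrakk> = (-4) *s zz (Suc n) + 2 *s ff n"
  and bracket_x_zz: "\<lbrakk>x, zz n\<rbrakk> = (-2) *s ee n"
proof -
  have split: "\<lbrakk>x, u\<rbrakk> = \<lbrakk>x + z, u\<rbrakk> - \<lbrakk>z, u\<rbrakk>" for u
    by (simp add: bracket_add_left)
  show "\<lbrakk>x, ee n\<rbrakk> = (-2) *s ee n" "\<lbrakk>x, ff n\<rbrakk> = (-4) *s zz (Suc n) + 2 *s ff n"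
    "\<lbrakk>x, zz n\<rbrakk> = (-2) *s ee n"
    unfolding split using bracket_ee_ee[of 0 n] bracket_ee_ff[of 0 n] bracket_e_zz[of n]
    by (simp_all add: bracket_z_ee bracket_z_ff bracket_z_zz)
qed

lemma bracket_y_ee: "\<lbrakk>y, ee n\<rbrakk> = 4 *s zz (Suc n) + (-2) *s ee n"
  and bracket_y_ff: "\<lbrakk>y, ff n\<rbrakk> = 2 *s ff n"
  and bracket_y_zz: "\<lbrakk>y, zz n\<rbrakk> = 2 *s ff n"
proof -
  have split: "\<lbrakk>y, u\<rbrakk> = \<lbrakk>y + z, u\<rbrakk> - \<lbrakk>z, u\<rbrakk>" for u
    by (simp add: bracket_add_left)
  show "\<lbrakk>y, ee n\<rbrakk> = 4 *s zz (Suc n) + (-2) *s ee n" "\<lbrakk>y, ff n\<rbrakk> = 2 *s ff n"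
    "\<lbrakk>y, zz n\<rbrakk> = 2 *s ff n"
    unfolding split
    using bracket_anticomm[of "ff 0" "ee n"] bracket_ee_ff[of n 0] bracket_ff_ff[of 0 n] bracket_f_zz[of n]
    by (simp_all add: bracket_z_ee bracket_z_ff bracket_z_zz)
qed

lemma bracket_x_XX: "\<lbrakk>x, XX n\<rbrakk> = 0"
  by (simp add: XX_def bracket_linear bracket_x_ee bracket_x_zz)

lemma bracket_y_YY: "\<lbrakk>y, YY n\<rbrakk> = 0"
  by (simp add: YY_def bracket_linear bracket_y_ff bracket_y_zz)

lemma bracket_z_WW: "\<lbrakk>z, WW n\<rbrakk> = 0"
  by (simp add: WW_def bracket_linear bracket_z_zz)

text \<open>Solved for \<open>WW n\<close>, and followed by \<open>bracket_x_WW\<close> and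
  \<open>bracket_y_WW\<close> solved for \<open>XX (Suc n)\<close> and \<open>YY (Suc n)\<close>,
  this is a recursion that produces all three families from \<open>x\<close> and
  \<open>y\<close>.\<close>

lemma bracket_x_YY: "\<lbrakk>x, YY n\<rbrakk> = 2 *s XX n + 2 *s YY n + 4 *s WW n"
proof (rule eq_by_functionals)
  fix g :: "'a \<Rightarrow> 'f" assume g: "Vector_Spaces.linear (*s) (*) g"
  show "g \<lbrakk>x, YY n\<rbrakk> = g (2 *s XX n + 2 *s YY n + 4 *s WW n)"
    unfolding YY_def WW_def XX_def bracket_diff_right bracket_x_ff bracket_x_zz linear_functional_simps[OF g]
    by algebra
qed

lemma bracket_y_XX: "\<lbrakk>y, XX n\<rbrakk> = - (2 *s XX n + 2 *s YY n + 4 *s WW n)"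
proof (rule eq_by_functionals)
  fix g :: "'a \<Rightarrow> 'f" assume g: "Vector_Spaces.linear (*s) (*) g"
  show "g \<lbrakk>y, XX n\<rbrakk> = g (- (2 *s XX n + 2 *s YY n + 4 *s WW n))"
    unfolding YY_def WW_def XX_def bracket_diff_right bracket_y_ee bracket_y_zz linear_functional_simps[OF g]
    by algebra
qed

lemma bracket_x_WW: "\<lbrakk>x, WW n\<rbrakk> = 2 *s XX (Suc n) - 2 *s XX n - 2 *s WW n"
proof (rule eq_by_functionals)
  fix g :: "'a \<Rightarrow> 'f" assume g: "Vector_Spaces.linear (*s) (*) g"
  show "g \<lbrakk>x, WW n\<rbrakk> = g (2 *s XX (Suc n) - 2 *s XX n - 2 *s WW n)"
    unfolding WW_def XX_def bracket_diff_right bracket_x_zz linear_functional_simps[OF g]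
    by algebra
qed

lemma bracket_y_WW: "\<lbrakk>y, WW n\<rbrakk> = 2 *s YY n - 2 *s YY (Suc n) + 2 *s WW n"
proof (rule eq_by_functionals)
  fix g :: "'a \<Rightarrow> 'f" assume g: "Vector_Spaces.linear (*s) (*) g"
  show "g \<lbrakk>y, WW n\<rbrakk> = g (2 *s YY n - 2 *s YY (Suc n) + 2 *s WW n)"
    unfolding WW_def YY_def bracket_diff_right bracket_y_zz linear_functional_simps[OF g]
    by algebra
qed

text \<open>Modulo the \<open>XX\<close>, which \<open>ad x\<close> kills, \<open>ad x\<close> is
  triangular on \<open>YY n\<close> and \<open>WW n\<close> with eigenvalues 2 and -2.\<close>

lemma ad_x_cube_YY: "\<lbrakk>x, \<lbrakk>x, \<lbrakk>x, YY n\<rbrakk>\<rbrakk>\<rbrakk> = 4 *s \<lbrakk>x, YY n\<rbrakk>"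
proof (rule eq_by_functionals)
  fix g :: "'a \<Rightarrow> 'f" assume g: "Vector_Spaces.linear (*s) (*) g"
  show "g \<lbrakk>x, \<lbrakk>x, \<lbrakk>x, YY n\<rbrakk>\<rbrakk>\<rbrakk> = g (4 *s \<lbrakk>x, YY n\<rbrakk>)"
    unfolding bracket_x_YY bracket_linear bracket_x_XX bracket_x_WW bracket_zero_right linear_functional_simps[OF g]
    by algebra
qed

lemma ad_y_cube_XX: "\<lbrakk>y, \<lbrakk>y, \<lbrakk>y, XX n\<rbrakk>\<rbrakk>\<rbrakk> = 4 *s \<lbrakk>y, XX n\<rbrakk>"
proof (rule eq_by_functionals)
  fix g :: "'a \<Rightarrow> 'f" assume g: "Vector_Spaces.linear (*s) (*) g"
  show "g \<lbrakk>y, \<lbrakk>y, \<lbrakk>y, XX n\<rbrakk>\<rbrakk>\<rbrakk> = g (4 *s \<lbrakk>y, XX n\<rbrakk>)"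
    unfolding bracket_y_XX bracket_linear bracket_y_YY bracket_y_WW bracket_zero_right linear_functional_simps[OF g]
    by algebra
qed

text \<open>The vector equals \<open>ee n + ff n - zz n - zz (Suc n)\<close>, a sum of eigenvectors
  of \<open>ad z\<close> for the eigenvalues 2, -2, 0, 0.\<close>

lemma ad_z_cube: "\<lbrakk>z, \<lbrakk>z, \<lbrakk>z, WW n + XX n + YY n\<rbrakk>\<rbrakk>\<rbrakk> = 4 *s \<lbrakk>z, WW n + XX n + YY n\<rbrakk>"
proof (rule eq_by_functionals)
  fix g :: "'a \<Rightarrow> 'f" assume g: "Vector_Spaces.linear (*s) (*) g"
  show "g \<lbrakk>z, \<lbrakk>z, \<lbrakk>z, WW n + XX n + YY n\<rbrakk>\<rbrakk>\<rbrakk> = g (4 *s \<lbrakk>z, WW n + XX n + YY n\<rbrakk>)"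
    unfolding WW_def XX_def YY_def bracket_linear bracket_z_ee bracket_z_ff bracket_z_zz
      bracket_zero_right linear_functional_simps[OF g]
    by algebra
qed

text \<open>
  The path with generators \<open>- x\<close>, \<open>- y\<close> and middle element \<open>v\<close> has the basis elements \<open>- XX n\<close>, \<open>- YY n\<close>,
  \<open>WW n + XX n + YY n\<close>, so \<open>WW n\<close> is a combination of eigenvectors of \<open>ad v\<close>.
\<close>

lemma ad_opposite_cube_WW:
  assumes "onsager_path (*s) bracket (- x) (- y) v"
  shows "\<lbrakk>v, \<lbrakk>v, \<lbrakk>v, WW n\<rbrakk>\<rbrakk>\<rbrakk> = 4 *s \<lbrakk>v, WW n\<rbrakk>"
proof -
  interpret opp: onsager_path "(*s)" bracket "- x" "- y" v by fact
  have W: "opp.WW n = WW n + XX n + YY n" if "opp.XX n = - XX n" "opp.YY n = - YY n" for n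
  proof (rule eq_by_functionals)
    fix g :: "'a \<Rightarrow> 'f" assume g: "Vector_Spaces.linear (*s) (*) g"
    have four: "(4 :: 'f) \<noteq> 0" by simp
    have "\<lbrakk>- x, - YY n\<rbrakk> = 2 *s (- XX n) + 2 *s (- YY n) + 4 *s opp.WW n"
      using opp.bracket_x_YY[of n] that by simp
    from arg_cong[OF this, of g]
    have "4 * g (opp.WW n) = 4 * g (WW n + XX n + YY n)"
      unfolding bracket_linear bracket_x_YY linear_functional_simps[OF g] by algebra
    then show "g (opp.WW n) = g (WW n + XX n + YY n)" by simp
  qed
  \<comment> \<open>The recursion for the families involves brackets with the two end generators
    only, so \<open>v\<close> does not enter the comparison.\<close>
  have XY: "opp.XX n = - XX n \<and> opp.YY n = - YY n" for n
  proof (induction n)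
    case 0
    then show ?case by (simp add: XX_0 YY_0 opp.XX_0 opp.YY_0)
  next
    case (Suc n)
    then have IH: "opp.XX n = - XX n" "opp.YY n = - YY n" "opp.WW n = WW n + XX n + YY n"
      using W by auto
    have "opp.XX (Suc n) = - XX (Suc n)"
    proof (rule eq_by_functionals)
      fix g :: "'a \<Rightarrow> 'f" assume g: "Vector_Spaces.linear (*s) (*) g"
      from arg_cong[OF opp.bracket_x_WW[of n], of g]
      have "2 * g (opp.XX (Suc n)) = 2 * g (- XX (Suc n))"
        unfolding IH bracket_linear bracket_x_WW bracket_x_XX bracket_x_YY linear_functional_simps[OF g]
        by algebra
      then show "g (opp.XX (Suc n)) = g (- XX (Suc n))" by simp
    qed
    moreover have "opp.YY (Suc n) = - YY (Suc n)"
    proof (rule eq_by_functionals)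
      fix g :: "'a \<Rightarrow> 'f" assume g: "Vector_Spaces.linear (*s) (*) g"
      from arg_cong[OF opp.bracket_y_WW[of n], of g]
      have "2 * g (opp.YY (Suc n)) = 2 * g (- YY (Suc n))"
        unfolding IH bracket_linear bracket_y_WW bracket_y_XX bracket_y_YY linear_functional_simps[OF g]
        by algebra
      then show "g (opp.YY (Suc n)) = g (- YY (Suc n))" by simp
    qed
    ultimately show ?case ..
  qed
  have "WW n = opp.WW n + opp.XX n + opp.YY n"
    using W XY by simp
  then show ?thesis
    using opp.ad_z_cube[of n] by simp
qed

section \<open>The generated subalgebra as the span of the three families\<close>

definition basis_span :: "'a set" where
  "basis_span = span (range XX \<union> range YY \<union> range WW)"

lemma basis_in_span: "XX n \<in> basis_span" "YY n \<in> basis_span" "WW n \<in> basis_span"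
  unfolding basis_span_def by (auto intro: span_base)

lemmas basis_span_closed =
  span_add[where S = "range XX \<union> range YY \<union> range WW", folded basis_span_def]
  span_diff[where S = "range XX \<union> range YY \<union> range WW", folded basis_span_def]
  span_scale[where S = "range XX \<union> range YY \<union> range WW", folded basis_span_def]
  span_neg[where S = "range XX \<union> range YY \<union> range WW", folded basis_span_def]
  span_zero[where S = "range XX \<union> range YY \<union> range WW", folded basis_span_def]

lemma basis_span_invariant:
  assumes "u \<in> basis_span" and "w \<in> {x, y}"
  shows "\<lbrakk>w, u\<rbrakk> \<in> basis_span"
  using assms(1) unfolding basis_span_def
proof (induction rule: span_induct)
  case base
  then show ?case
    using basis_in_span basis_span_closed assms(2)
    by (auto simp: subspace_def bracket_linear basis_span_def[symmetric])
next
  case (step u)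
  then show ?case
    using assms(2)
    by (auto simp: bracket_x_XX bracket_x_YY bracket_x_WW bracket_y_XX bracket_y_YY bracket_y_WW
        basis_span_def[symmetric] intro!: basis_span_closed basis_in_span)
qed

lemma generated_eq_basis_span: "lie_subalgebra hull {x, y} = basis_span"
proof
  let ?H = "lie_subalgebra hull {x, y}"
  \<comment> \<open>By the Jacobi identity the elements of \<open>basis_span\<close> whose
    \<open>ad\<close> preserves \<open>basis_span\<close> form a subalgebra. Brackets with
    \<open>x\<close> and \<open>y\<close> therefore suffice, and no products of two general spanning
    elements are computed.\<close>
  define S where "S = {u \<in> basis_span. \<forall>w\<in>basis_span. \<lbrakk>u, w\<rbrakk> \<in> basis_span}"
  have "lie_subalgebra S"
    unfolding lie_subalgebra_def
  proof (intro conjI ballI)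
    show "subspace S"
      unfolding subspace_def S_def by (auto simp: bracket_linear intro: basis_span_closed)
    fix u v assume uv: "u \<in> S" "v \<in> S"
    have "\<lbrakk>\<lbrakk>u, v\<rbrakk>, w\<rbrakk> \<in> basis_span" if "w \<in> basis_span" for w
    proof -
      have "\<lbrakk>\<lbrakk>u, v\<rbrakk>, w\<rbrakk> = \<lbrakk>u, \<lbrakk>v, w\<rbrakk>\<rbrakk> - \<lbrakk>v, \<lbrakk>u, w\<rbrakk>\<rbrakk>"
        using bracket_derivation[of u v w] by simp
      then show ?thesis
        using uv that by (auto simp: S_def intro: basis_span_closed)
    qed
    then show "\<lbrakk>u, v\<rbrakk> \<in> S"
      using uv by (auto simp: S_def)
  qed
  moreover have "{x, y} \<subseteq> S"
    using basis_span_invariant basis_in_span(1,2)[of 0] by (auto simp: S_def XX_0 YY_0)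
  ultimately show "?H \<subseteq> basis_span"
    using hull_minimal[of "{x, y}" S lie_subalgebra] by (auto simp: S_def)
next
  let ?H = "lie_subalgebra hull {x, y}"
  have "lie_subalgebra ?H"
    by (rule hull_in) (auto simp: lie_subalgebra_def intro: subspace_Inter)
  then have sub: "subspace ?H" and br: "\<And>u v. u \<in> ?H \<Longrightarrow> v \<in> ?H \<Longrightarrow> \<lbrakk>u, v\<rbrakk> \<in> ?H"
    by (auto simp: lie_subalgebra_def)
  have xy: "x \<in> ?H" "y \<in> ?H"
    by (simp_all add: hull_inc)
  \<comment> \<open>Conversely, the recursion for the families stays inside any subalgebra
    containing \<open>x\<close> and \<open>y\<close>, since 2 and 4 are invertible.\<close>
  have W: "WW n \<in> ?H" if "XX n \<in> ?H" "YY n \<in> ?H" for n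
  proof -
    have "4 *s WW n = \<lbrakk>x, YY n\<rbrakk> - 2 *s XX n - 2 *s YY n"
      by (simp add: bracket_x_YY)
    also have "\<dots> \<in> ?H"
      by (intro subspace_diff subspace_scale sub br xy that)
    finally have "(1 / 4) *s (4 *s WW n) \<in> ?H"
      by (rule subspace_scale[OF sub])
    then show ?thesis by simp
  qed
  have XY: "XX n \<in> ?H \<and> YY n \<in> ?H" for n
  proof (induction n)
    case 0
    then show ?case by (simp add: XX_0 YY_0 xy)
  next
    case (Suc n)
    then have IH: "XX n \<in> ?H" "YY n \<in> ?H" "WW n \<in> ?H"
      using W by auto
    have "2 *s XX (Suc n) = \<lbrakk>x, WW n\<rbrakk> + 2 *s XX n + 2 *s WW n"
      by (simp add: bracket_x_WW)
    also have "\<dots> \<in> ?H"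
      by (intro subspace_add subspace_scale sub br xy IH)
    finally have X: "(1 / 2) *s (2 *s XX (Suc n)) \<in> ?H"
      by (rule subspace_scale[OF sub])
    have "2 *s YY (Suc n) = 2 *s YY n + 2 *s WW n - \<lbrakk>y, WW n\<rbrakk>"
      by (simp add: bracket_y_WW)
    also have "\<dots> \<in> ?H"
      by (intro subspace_add subspace_diff subspace_scale sub br xy IH)
    finally have "(1 / 2) *s (2 *s YY (Suc n)) \<in> ?H"
      by (rule subspace_scale[OF sub])
    with X show ?case by simp
  qed
  then have "range XX \<union> range YY \<union> range WW \<subseteq> ?H"
    using W by auto
  then show "basis_span \<subseteq> ?H"
    unfolding basis_span_def by (rule span_minimal[OF _ sub])
qed

end

section \<open>Polynomial coordinates along a sequence of vectors\<close>

context lie_algebra_char_0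
begin

text \<open>With \<open>v n\<close> read as \<open>v t^n\<close>, this is \<open>v\<close> times the
  polynomial \<alpha> in \<open>t\<close>. In a representation where \<open>t\<close> acts as a
  scalar, it becomes evaluation of \<alpha> at that scalar.\<close>

definition poly_comb :: "(nat \<Rightarrow> 'a) \<Rightarrow> 'f poly \<Rightarrow> 'a" where
  "poly_comb v \<alpha> = (\<Sum>i\<le>degree \<alpha>. coeff \<alpha> i *s v i)"

lemma poly_comb_upto:
  assumes "degree \<alpha> \<le> n"
  shows "poly_comb v \<alpha> = (\<Sum>i\<le>n. coeff \<alpha> i *s v i)"
  unfolding poly_comb_def using assms
  by (intro sum.mono_neutral_left) (auto simp: coeff_eq_0)

lemma poly_comb_0: "poly_comb v 0 = 0"
  by (simp add: poly_comb_def)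

lemma poly_comb_add: "poly_comb v (\<alpha> + \<beta>) = poly_comb v \<alpha> + poly_comb v \<beta>"
proof -
  let ?n = "max (degree \<alpha>) (degree \<beta>)"
  have "poly_comb v (\<alpha> + \<beta>) = (\<Sum>i\<le>?n. coeff (\<alpha> + \<beta>) i *s v i)"
    by (rule poly_comb_upto) (rule degree_add_le_max)
  moreover have "poly_comb v \<alpha> = (\<Sum>i\<le>?n. coeff \<alpha> i *s v i)"
    "poly_comb v \<beta> = (\<Sum>i\<le>?n. coeff \<beta> i *s v i)"
    by (simp_all add: poly_comb_upto)
  ultimately show ?thesis
    by (simp add: scale_left_distrib sum.distrib)
qed

lemma poly_comb_smult: "poly_comb v (smult c \<alpha>) = c *s poly_comb v \<alpha>"
  using poly_comb_upto[of "smult c \<alpha>" "degree \<alpha>" v]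
  by (simp add: poly_comb_def scale_sum_right degree_smult_le)

lemma poly_comb_monom: "poly_comb v (monom 1 n) = v n"
proof -
  have "poly_comb v (monom 1 n) = (\<Sum>i\<le>n. if i = n then v i else 0)"
    by (simp add: poly_comb_def degree_monom_eq if_distrib[of "\<lambda>c. c *s _"] cong: if_cong)
  then show ?thesis by simp
qed

lemma span_range_poly_comb: "u \<in> span (range v) \<Longrightarrow> \<exists>\<alpha>. u = poly_comb v \<alpha>"
proof (induction rule: span_induct)
  case base
  show ?case
    unfolding subspace_def
  proof (intro conjI ballI allI)
    show "0 \<in> {u. \<exists>\<alpha>. u = poly_comb v \<alpha>}"
      by (auto intro: exI[of _ 0] simp: poly_comb_0)
    fix u w and c :: 'f
    assume "u \<in> {u. \<exists>\<alpha>. u = poly_comb v \<alpha>}"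
    then obtain \<alpha> where u: "u = poly_comb v \<alpha>" by auto
    show "c *s u \<in> {u. \<exists>\<alpha>. u = poly_comb v \<alpha>}"
      by (auto simp: u simp flip: poly_comb_smult)
    assume "w \<in> {u. \<exists>\<alpha>. u = poly_comb v \<alpha>}"
    then show "u + w \<in> {u. \<exists>\<alpha>. u = poly_comb v \<alpha>}"
      by (auto simp: u simp flip: poly_comb_add)
  qed
next
  case (step u)
  then show ?case by (metis poly_comb_monom rangeE)
qed

end

section \<open>Evaluation of formal Lie expressions\<close>

context lie_algebra
begin

primrec eval_term :: "('g \<Rightarrow> 'a) \<Rightarrow> ('f, 'g) lie_term \<Rightarrow> 'a" where
  "eval_term h (Gen g) = h g"
| "eval_term h Zero = 0"
| "eval_term h (Plus s t) = eval_term h s + eval_term h t"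
| "eval_term h (Scale c s) = scale c (eval_term h s)"
| "eval_term h (Bracket s t) = bracket (eval_term h s) (eval_term h t)"

text \<open>The universal property of the presentation: images of the generators that satisfy
  \<open>R\<close> determine a map on the quotient.\<close>

lemma eval_term_respects:
  assumes "lie_eq R s t" and "\<And>s t. R s t \<Longrightarrow> eval_term h s = eval_term h t"
  shows "eval_term h s = eval_term h t"
  using assms(1)
proof (induction rule: lie_eq.induct)
  case (Jacobi s t u)
  then show ?case
    using jacobi by simp
next
  case (Plus_neg s)
  then show ?case
    by (metis eval_term.simps(2,3,4) add.left_inverse scale_minus_left scale_one)
qed (simp_all add: assms(2) bracket_add_left bracket_add_right bracket_scale_left bracket_scale_right
    bracket_self scale_right_distrib scale_left_distrib add.assoc add.commute)

end

section \<open>Representation by quadratic vector fields\<close>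

text \<open>The Lie bracket of the vector fields \<open>f d/du\<close> and
  \<open>g d/du\<close>.\<close>

definition wronskian :: "'f::field poly \<Rightarrow> 'f poly \<Rightarrow> 'f poly" where
  "wronskian f g = f * pderiv g - pderiv f * g"

interpretation wronskian: lie_algebra smult wronskian
  by standard (simp_all add: wronskian_def pderiv_add pderiv_smult pderiv_diff pderiv_mult
      smult_add_right smult_add_left smult_diff_right algebra_simps)

lemma wronskian_quadratic:
  "wronskian [:a0, a1, a2:] [:b0, b1, b2:] =
    [:a0 * b1 - a1 * b0, 2 * (a0 * b2 - a2 * b0), a1 * b2 - a2 * b1:]"
  by (simp add: wronskian_def pderiv_pCons algebra_simps)

text \<open>Quadratic fields form a copy of sl2, in which \<open>ad P\<close> has as eigenvalues 0
  and the two square roots of the discriminant of \<open>P\<close>.\<close>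

lemma wronskian_quadratic_cube:
  fixes a0 a1 a2 b0 b1 b2 :: "'f::field"
  defines "P \<equiv> [:a0, a1, a2:]" and "Q \<equiv> [:b0, b1, b2:]"
  shows "wronskian P (wronskian P (wronskian P Q)) = smult (a1\<^sup>2 - 4 * a0 * a2) (wronskian P Q)"
  unfolding P_def Q_def wronskian_quadratic
  by (simp add: algebra_simps power2_eq_square)

text \<open>
  The quadratic vector field on the projective line that vanishes at the points \<open>a i\<close> and \<open>a j\<close>,
  normalized so that its derivatives there are \<open>- 2\<close> and \<open>2\<close>.
\<close>

definition quad :: "('i \<Rightarrow> 'f::field) \<Rightarrow> 'i \<Rightarrow> 'i \<Rightarrow> 'f poly" where
  "quad a i j = smult (- 2 / (a i - a j)) ([:- a i, 1:] * [:- a j, 1:])"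

lemma poly_quad: "poly (quad a i j) u = - 2 / (a i - a j) * ((u - a i) * (u - a j))"
  by (simp only: quad_def poly_smult poly_mult) simp

lemma quad_coeffs:
  fixes a :: "'i \<Rightarrow> 'f::field"
  shows
  "quad a i j = [:- 2 / (a i - a j) * (a i * a j), - (- 2 / (a i - a j) * (a i + a j)), - 2 / (a i - a j):]"
proof -
  have "smult c ([:- x, 1:] * [:- y, 1:]) = [:c * (x * y), - (c * (x + y)), c:]" for c x y :: 'f
    by (simp add: algebra_simps)
  then show ?thesis
    by (simp only: quad_def)
qed

lemma quad_antisym: "quad a i j + quad a j i = 0"
proof -
  have "- 2 / (a i - a j) = - (- 2 / (a j - a i))"
    by (metis minus_diff_eq minus_divide_right)
  then show ?thesis
    by (simp add: quad_def mult.commute)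
qed

lemma quad_triangle:
  assumes "a i \<noteq> a j" "a j \<noteq> a k"
  shows "wronskian (quad a i j) (quad a j k) = smult 2 (quad a i j) + smult 2 (quad a j k)"
proof -
  define c d where "c = - 2 / (a i - a j)" and "d = - 2 / (a j - a k)"
  have "c * (a i - a j) = - 2" "d * (a j - a k) = - 2"
    using assms unfolding c_def d_def by (metis nonzero_eq_divide_eq right_minus_eq)+
  then have
    "c * (a i * a j) * - (d * (a j + a k)) - - (c * (a i + a j)) * (d * (a j * a k))
      = 2 * (c * (a i * a j)) + 2 * (d * (a j * a k))"
    "2 * (c * (a i * a j) * d - c * (d * (a j * a k)))
      = 2 * - (c * (a i + a j)) + 2 * - (d * (a j + a k))"
    "- (c * (a i + a j)) * d - c * - (d * (a j + a k)) = 2 * c + 2 * d"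
    by algebra+
  then show ?thesis
    unfolding quad_coeffs wronskian_quadratic c_def[symmetric] d_def[symmetric] by simp
qed

text \<open>The normalization gives \<open>quad a i j\<close> discriminant 4.\<close>

lemma quad_dolan_grady:
  assumes "a i \<noteq> a j"
  shows "wronskian (quad a i j) (wronskian (quad a i j) (wronskian (quad a i j) (quad a k h)))
    = smult 4 (wronskian (quad a i j) (quad a k h))"
proof -
  define c where "c = - 2 / (a i - a j)"
  have "c * (a i - a j) = - 2"
    using assms unfolding c_def by (metis nonzero_eq_divide_eq right_minus_eq)
  then have "(- (c * (a i + a j)))\<^sup>2 - 4 * (c * (a i * a j)) * c = 4"
    by algebra
  then show ?thesis
    unfolding quad_coeffs wronskian_quadratic_cube by (simp only: c_def)
qed

text \<open>At a zero of \<open>quad a i j\<close> the term with \<open>pderiv g\<close> drops out,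
  leaving the nonzero derivative of \<open>quad a i j\<close> times the value of
  \<open>g\<close>.\<close>

lemma quad_centralizer:
  fixes a :: "'i \<Rightarrow> 'f::field_char_0"
  assumes "a i \<noteq> a j" and "wronskian (quad a i j) g = 0"
  shows "poly g (a i) = 0" "poly g (a j) = 0"
proof -
  have eq: "poly (quad a i j) u * poly (pderiv g) u = poly (pderiv (quad a i j)) u * poly g u" for u
    using arg_cong[OF assms(2), of "\<lambda>p. poly p u"] by (simp add: wronskian_def)
  have "poly (pderiv (quad a i j)) u = - 2 / (a i - a j) * (2 * u - a i - a j)" for u
    by (simp only: quad_def pderiv_smult poly_smult) (simp add: pderiv_mult pderiv_pCons)
  then show "poly g (a i) = 0" "poly g (a j) = 0"
    using eq[of "a i"] eq[of "a j"] assms(1) by (simp_all add: poly_quad)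
qed

text \<open>The images of \<open>e\<close> and \<open>f\<close> are multiples of the squares of
  \<open>u - a r\<close> and \<open>u - a q\<close>, and the bracket of two such squares is a
  multiple of \<open>quad a q r\<close>. The factor is -4 times a cross-ratio, to be compared with
  \<open>[e, f] = -4 z1\<close>.\<close>

lemma quad_path_weights:
  fixes a :: "'i \<Rightarrow> 'f::field_char_0"
  assumes "a p \<noteq> a q" "a q \<noteq> a r" "a r \<noteq> a s"
  shows "wronskian (quad a r s + quad a q r) (quad a p q + quad a q r) =
    smult (- 4 * (((a q - a s) * (a p - a r)) / ((a r - a s) * (a p - a q)))) (quad a q r)"
proof -
  define c where "c i j = - 2 / (a i - a j)" for i j
  have c: "c i j * (a i - a j) = - 2" if "a i \<noteq> a j" for i j
    using that unfolding c_def by (metis nonzero_eq_divide_eq right_minus_eq)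
  have sum: "quad a i j + quad a j k = smult (- (c i j * c j k * (a i - a k) / 2)) ([:- a j, 1:]\<^sup>2)"
    if "a i \<noteq> a j" "a j \<noteq> a k" for i j k
  proof -
    define e where "e = c i j * c j k * (a i - a k) / 2"
    have e: "2 * e = c i j * c j k * (a i - a k)"
      by (simp add: e_def)
    have "2 * (c i j * (a i * a j) + c j k * (a j * a k)) = 2 * - (e * (a j * a j))"
      "2 * (- (c i j * (a i + a j)) + - (c j k * (a j + a k))) = 2 * (e * a j + e * a j)"
      "2 * (c i j + c j k) = 2 * - e"
      using c[OF that(1)] c[OF that(2)] e by algebra+
    then have "c i j * (a i * a j) + c j k * (a j * a k) = - (e * (a j * a j))"
      "- (c i j * (a i + a j)) + - (c j k * (a j + a k)) = e * a j + e * a j"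
      "c i j + c j k = - e"
      by (simp_all only: mult_cancel_left) simp_all
    then show ?thesis
      unfolding quad_coeffs c_def[symmetric] e_def[symmetric] by (simp add: power2_eq_square)
  qed
  have w: "wronskian ([:- b, 1:]\<^sup>2) ([:- c, 1:]\<^sup>2) = smult (2 * (c - b)) ([:- c, 1:] * [:- b, 1:])" for b c :: 'f
    by (simp add: wronskian_def power2_eq_square pderiv_mult pderiv_pCons algebra_simps)
  have "- 4 * ((a q - a s) * (a p - a r) / ((a r - a s) * (a p - a q)))
    = - (c r s * c p q * (a q - a s) * (a p - a r))"
  proof -
    have "c r s * c p q = 4 / ((a r - a s) * (a p - a q))"
      by (simp add: c_def)
    then show ?thesis
      by (simp only: mult.assoc) (simp add: mult.commute[of 4])
  qed
  moreover have "- (c p q * c q r * (a p - a r) / 2) * (- (c q r * c r s * (a q - a s) / 2) * (2 * (a q - a r)))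
    = - (c r s * c p q * (a q - a s) * (a p - a r)) * c q r"
    using c[OF assms(2)] by algebra
  ultimately show ?thesis
    unfolding add.commute[of "quad a r s"] sum[OF assms(2,3)] sum[OF assms(1,2)]
      wronskian.bracket_scale_left wronskian.bracket_scale_right w
    unfolding quad_def smult_smult c_def[symmetric] by (simp only: mult.assoc)
qed

lemma quad_path_independent:
  fixes a :: "'i \<Rightarrow> 'f::field_char_0"
  assumes "a p \<noteq> a q" "a q \<noteq> a r" "a r \<noteq> a s" "a p \<noteq> a r" "a q \<noteq> a s" "a p \<noteq> a s"
    and "smult A (quad a r s) + smult B (quad a p q) + smult C (quad a q r) = 0"
  shows "A = 0" "B = 0" "C = 0"
proof -
  have eq: "A * poly (quad a r s) u + B * poly (quad a p q) u + C * poly (quad a q r) u = 0" for u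
    using arg_cong[OF assms(7), of "\<lambda>p. poly p u"] by simp
  \<comment> \<open>At \<open>a q\<close> and at \<open>a r\<close>, two of the three fields
    vanish.\<close>
  show A: "A = 0" and B: "B = 0"
    using eq[of "a q"] eq[of "a r"] assms(1-6) by (simp_all add: poly_quad)
  show "C = 0"
    using eq[of "a p"] A assms(1-6) by (simp add: poly_quad)
qed

text \<open>Vanishing at both ends of an edge forces a field to be a multiple of the field of that
  edge, and the three edge fields are independent.\<close>

lemma quad_path_direct:
  fixes a :: "'i \<Rightarrow> 'f::field_char_0"
  assumes ne: "a p \<noteq> a q" "a q \<noteq> a r" "a r \<noteq> a s" "a p \<noteq> a r" "a q \<noteq> a s" "a p \<noteq> a s"
    and U: "U = smult A1 (quad a r s) + smult B1 (quad a p q) + smult C1 (quad a q r)"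
    and V: "V = smult A2 (quad a r s) + smult B2 (quad a p q) + smult C2 (quad a q r)"
    and W: "W = smult A3 (quad a r s) + smult B3 (quad a p q) + smult C3 (quad a q r)"
    and zeros: "poly U (a p) = 0" "poly U (a q) = 0" "poly V (a q) = 0" "poly V (a r) = 0"
      "poly W (a r) = 0" "poly W (a s) = 0"
    and sum: "U + V + W = 0"
  shows "U = 0" "V = 0" "W = 0"
proof -
  have "A1 = 0" "A2 = 0" "B2 = 0" "B3 = 0"
    using zeros(2-5) ne unfolding U V W by (simp_all add: poly_quad)
  moreover from this have "C1 = 0" "C3 = 0"
    using zeros(1,6) ne unfolding U V W by (simp_all add: poly_quad)
  ultimately have UVW: "U = smult B1 (quad a p q)" "V = smult C2 (quad a q r)" "W = smult A3 (quad a r s)"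
    by (simp_all add: U V W)
  have "smult A3 (quad a r s) + smult B1 (quad a p q) + smult C2 (quad a q r) = 0"
    using sum by (simp add: UVW algebra_simps)
  then show "U = 0" "V = 0" "W = 0"
    using quad_path_independent[of a p q r s, OF ne] by (auto simp: UVW)
qed

section \<open>The representation of the tetrahedron algebra given by four distinct points\<close>

definition tetra_rep :: "(4 \<Rightarrow> 'f::field_char_0) \<Rightarrow> 'f tetra \<Rightarrow> 'f poly" where
  "tetra_rep a u = wronskian.eval_term (\<lambda>g. case Rep_tetra_gen g of (i, j) \<Rightarrow> quad a i j) (rep_tetra u)"

context
  fixes a :: "4 \<Rightarrow> 'f::field_char_0"
  assumes inj_a: "inj a"
begin

text \<open>Independence of the representative chosen in \<open>tetra_rep\<close>: for distinct
  points the fields \<open>quad a i j\<close> satisfy the defining relations.\<close>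

lemma tetra_rep_abs:
  "tetra_rep a (abs_tetra t) = wronskian.eval_term (\<lambda>g. case Rep_tetra_gen g of (i, j) \<Rightarrow> quad a i j) t"
proof -
  have gen: "Rep_tetra_gen (Abs_tetra_gen (i, j)) = (i, j)" if "i \<noteq> j" for i j
    using that by (simp add: Abs_tetra_gen_inverse)
  have neq: "a i \<noteq> a j" if "i \<noteq> j" for i j
    using inj_a that by (auto dest: injD)
  have "lie_eq tetra_rel (rep_tetra (abs_tetra t)) t"
    using Quotient3_rep_abs[OF Quotient3_tetra, of t] lie_eq.refl by blast
  then show ?thesis
    unfolding tetra_rep_def
  proof (rule wronskian.eval_term_respects)
    fix s t :: "('f, tetra_gen) lie_term"
    assume "tetra_rel s t"
    then show "wronskian.eval_term (\<lambda>g. case Rep_tetra_gen g of (i, j) \<Rightarrow> quad a i j) s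
      = wronskian.eval_term (\<lambda>g. case Rep_tetra_gen g of (i, j) \<Rightarrow> quad a i j) t"
    proof cases
      case (antisym i j)
      then show ?thesis by (simp add: gen quad_antisym)
    next
      case (triangle i j k)
      then show ?thesis by (simp add: gen neq quad_triangle)
    next
      case (dolan_grady h i j k)
      then have "k \<noteq> h" by auto
      then show ?thesis using dolan_grady by (simp add: gen neq quad_dolan_grady)
    qed
  qed
qed

lemma tetra_rep_hom:
  "tetra_rep a 0 = 0"
  "tetra_rep a (u + v) = tetra_rep a u + tetra_rep a v"
  "tetra_rep a (tetra_scale c u) = smult c (tetra_rep a u)"
  "tetra_rep a (tetra_bracket u v) = wronskian (tetra_rep a u) (tetra_rep a v)"
proof -
  show "tetra_rep a 0 = 0"
    by (simp add: zero_tetra.abs_eq tetra_rep_abs)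
  show "tetra_rep a (u + v) = tetra_rep a u + tetra_rep a v"
    by (induction u rule: tetra.abs_induct, induction v rule: tetra.abs_induct)
      (simp add: plus_tetra.abs_eq tetra_rep_abs)
  show "tetra_rep a (tetra_scale c u) = smult c (tetra_rep a u)"
    by (induction u rule: tetra.abs_induct) (simp add: tetra_scale.abs_eq tetra_rep_abs)
  show "tetra_rep a (tetra_bracket u v) = wronskian (tetra_rep a u) (tetra_rep a v)"
    by (induction u rule: tetra.abs_induct, induction v rule: tetra.abs_induct)
      (simp add: tetra_bracket.abs_eq tetra_rep_abs)
qed

lemma tetra_rep_diff: "tetra_rep a (u - v) = tetra_rep a u - tetra_rep a v"
  using tetra_rep_hom(2)[of "u - v" v] by simp

lemma tetra_rep_minus: "tetra_rep a (- u) = - tetra_rep a u"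
  using tetra_rep_diff[of 0 u] by (simp add: tetra_rep_hom)

lemma tetra_rep_x: "i \<noteq> j \<Longrightarrow> tetra_rep a (tetra_x i j) = quad a i j"
  by (simp add: tetra_x.abs_eq tetra_rep_abs Abs_tetra_gen_inverse)

end

interpretation tetra: lie_algebra_char_0 tetra_scale tetra_bracket ..

lemma tetra_rep_poly_comb:
  assumes "inj a" and "\<And>n. tetra_rep a (v n) = smult (\<tau> ^ n) g"
  shows "tetra_rep a (tetra.poly_comb v \<alpha>) = smult (poly \<alpha> \<tau>) g"
proof -
  have "tetra_rep a (\<Sum>i\<in>I. tetra_scale (f i) (v i)) = smult (\<Sum>i\<in>I. f i * \<tau> ^ i) g"
    if "finite I" for I f
    using that
    by (induction rule: finite_induct)
      (simp_all add: tetra_rep_hom[OF assms(1)] assms(2) smult_add_left)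
  then show ?thesis
    by (simp add: tetra.poly_comb_def poly_altdef)
qed

section \<open>The decompositions\<close>

lemma four_indices:
  fixes p q r s i :: 4
  assumes "distinct [p, q, r, s]"
  shows "i \<in> {p, q, r, s}"
proof -
  have "card {p, q, r, s} = CARD(4)"
    using assms by simp
  then have "{p, q, r, s} = UNIV"
    by (intro card_eq_UNIV_imp_eq_UNIV) simp_all
  then show ?thesis by simp
qed

lemma tetra_x_flip: "i \<noteq> j \<Longrightarrow> tetra_x j i = - tetra_x i j"
  using tetra_x_antisym[of i j] by (simp add: eq_neg_iff_add_eq_0 add.commute)

text \<open>One orientation of the complementary pair suffices, since both sides of the cubic
  relation are odd in \<open>tetra_x r s\<close>.\<close>

lemma x_likeI:
  fixes \<xi> :: "'f::field_char_0 tetra"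
  assumes "distinct [p, q, r, s]" and "tetra_bracket (tetra_x p q) \<xi> = 0"
    and cube: "tetra_bracket (tetra_x r s) (tetra_bracket (tetra_x r s) (tetra_bracket (tetra_x r s) \<xi>))
      = tetra_scale 4 (tetra_bracket (tetra_x r s) \<xi>)"
  shows "\<xi> \<in> X_space p q"
  unfolding X_space_def x_like_def
proof (intro CollectI conjI allI impI)
  fix h k
  assume hk: "distinct [h, p, q, k]"
  have "h \<in> {p, q, r, s}" "k \<in> {p, q, r, s}"
    using four_indices[OF assms(1)] by blast+
  with hk have "tetra_x k h = (tetra_x r s :: 'f tetra) \<or> tetra_x k h = - (tetra_x r s :: 'f tetra)"
    using assms(1) tetra_x_flip[of r s] by auto
  then show "tetra_bracket (tetra_x k h) (tetra_bracket (tetra_x k h) (tetra_bracket (tetra_x k h) \<xi>))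
    = tetra_scale 4 (tetra_bracket (tetra_x k h) \<xi>)"
    using cube by (auto simp: tetra.bracket_linear)
qed (fact assms(2))

lemma subspace_X_space: "tetra.subspace (X_space i j :: 'f::field_char_0 tetra set)"
  unfolding tetra.subspace_def X_space_def x_like_def
  by (simp add: tetra.bracket_linear tetra.scale_right_distrib tetra.scale_left_commute)

lemma tetra_onsager_path:
  "distinct [p, q, r, s] \<Longrightarrow>
    onsager_path tetra_scale tetra_bracket (tetra_x r s) (tetra_x p q) (tetra_x q r :: 'f::field_char_0 tetra)"
  by unfold_locales (auto intro!: tetra_x_triangle tetra_x_dolan_grady)

lemma onsager_decomposition:
  fixes p q r s :: 4
  assumes d: "distinct [p, q, r, s]"
  defines "Ons \<equiv> tetra.lie_subalgebra hull {tetra_x r s, tetra_x p q :: 'f::field_char_0 tetra}"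
  shows "Ons = (X_space p q \<inter> Ons) + (X_space q r \<inter> Ons) + (X_space r s \<inter> Ons)"
    and "direct_sum3 (X_space p q \<inter> Ons) (X_space q r \<inter> Ons) (X_space r s \<inter> Ons)"
proof -
  interpret P: onsager_path tetra_scale tetra_bracket "tetra_x r s" "tetra_x p q" "tetra_x q r :: 'f tetra"
    by (rule tetra_onsager_path[OF d])
  have opp: "onsager_path tetra_scale tetra_bracket (- tetra_x r s) (- tetra_x p q) (tetra_x p s :: 'f tetra)"
  proof -
    have "distinct [q, p, s, r]" "r \<noteq> s" "p \<noteq> q"
      using d by auto
    then show ?thesis
      using tetra_onsager_path[of q p s r] by (simp add: tetra_x_flip[of r s] tetra_x_flip[of p q])
  qed
  have Ons: "Ons = P.basis_span"
    by (simp add: Ons_def P.generated_eq_basis_span)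
  have sub: "tetra.subspace Ons"
    unfolding Ons P.basis_span_def by simp
  have XX: "P.XX n \<in> X_space r s" for n
    by (rule x_likeI[of r s p q]) (use d P.bracket_x_XX P.ad_y_cube_XX in auto)
  have YY: "P.YY n \<in> X_space p q" for n
    by (rule x_likeI[of p q r s]) (use d P.bracket_y_YY P.ad_x_cube_YY in auto)
  \<comment> \<open>The pair complementary to \<open>q\<close>, \<open>r\<close> is
    \<open>p\<close>, \<open>s\<close>, and \<open>tetra_x p s\<close> is the middle element of the
    opposite path.\<close>
  have WW: "P.WW n \<in> X_space q r" for n
    by (rule x_likeI[of q r p s]) (use d P.bracket_z_WW P.ad_opposite_cube_WW[OF opp] in auto)
  have decompose: "\<exists>\<alpha> \<beta> \<gamma>. u = tetra.poly_comb P.YY \<beta> + tetra.poly_comb P.WW \<gamma> + tetra.poly_comb P.XX \<alpha>"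
    if "u \<in> Ons" for u
  proof -
    have "u \<in> tetra.span (range P.YY \<union> range P.WW \<union> range P.XX)"
      using that unfolding Ons P.basis_span_def by (simp add: Un_ac)
    then show ?thesis
      unfolding tetra.span_Un by (blast dest: tetra.span_range_poly_comb)
  qed
  have comb_in: "tetra.poly_comb v \<alpha> \<in> U \<inter> Ons"
    if "\<And>n. v n \<in> U" "\<And>n. v n \<in> P.basis_span" "tetra.subspace U" for v \<alpha> U
    unfolding tetra.poly_comb_def using that sub
    by (auto intro!: tetra.subspace_sum tetra.subspace_scale simp: Ons)
  show "Ons = (X_space p q \<inter> Ons) + (X_space q r \<inter> Ons) + (X_space r s \<inter> Ons)"
  proof
    show "Ons \<subseteq> (X_space p q \<inter> Ons) + (X_space q r \<inter> Ons) + (X_space r s \<inter> Ons)"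
    proof
      fix u assume "u \<in> Ons"
      from decompose[OF this] show "u \<in> (X_space p q \<inter> Ons) + (X_space q r \<inter> Ons) + (X_space r s \<inter> Ons)"
        using comb_in[of P.XX, OF XX P.basis_in_span(1) subspace_X_space]
          comb_in[of P.YY, OF YY P.basis_in_span(2) subspace_X_space]
          comb_in[of P.WW, OF WW P.basis_in_span(3) subspace_X_space]
        by (blast intro: set_plus_intro)
    qed
  next
    show "(X_space p q \<inter> Ons) + (X_space q r \<inter> Ons) + (X_space r s \<inter> Ons) \<subseteq> Ons"
      using tetra.subspace_add[OF sub] by (auto elim!: set_plus_elim)
  qed

  \<comment> \<open>The points at \<open>p\<close>, \<open>q\<close>, \<open>r\<close>,
    \<open>s\<close> are \<open>c\<close>, 0, 1, -1, distinct for \<open>c\<close> in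
    \<open>S\<close>. The cross-ratio from \<open>quad_path_weights\<close> is then
    \<open>\<tau> c\<close>, which is injective in \<open>c\<close> and so takes infinitely many
    values.\<close>
  define pts where "pts c = (\<lambda>i. if i = p then c else if i = q then 0 else if i = r then 1 else - 1 :: 'f)" for c
  define S where "S = - {0, 1, - 1 :: 'f}"
  define \<tau> where "\<tau> c = (c - 1) / (2 * c)" for c :: 'f
  have inj_pts: "inj (pts c)" if "c \<in> S" for c
  proof (rule injI)
    fix i j assume "pts c i = pts c j"
    then show "i = j"
      using that four_indices[OF d, of i] four_indices[OF d, of j] d
      by (auto simp: pts_def S_def split: if_splits)
  qed
  have ne: "pts c p \<noteq> pts c q" "pts c q \<noteq> pts c r" "pts c r \<noteq> pts c s"
    "pts c p \<noteq> pts c r" "pts c q \<noteq> pts c s" "pts c p \<noteq> pts c s" if "c \<in> S" for c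
    using inj_pts[OF that] d by (auto simp: inj_eq)
  have inf: "infinite (\<tau> ` S)"
  proof -
    have "inj_on \<tau> S"
      by (rule inj_onI) (auto simp: \<tau>_def S_def field_simps)
    moreover have "infinite S"
      unfolding S_def Compl_eq_Diff_UNIV by (intro Diff_infinite_finite) (simp_all add: infinite_UNIV_char_0)
    ultimately show ?thesis
      using finite_imageD by blast
  qed
  have rep_u: "tetra_rep (pts c) (tetra.poly_comb P.YY \<beta> + tetra.poly_comb P.WW \<gamma> + tetra.poly_comb P.XX \<alpha>)
    = smult (poly \<alpha> (\<tau> c)) (quad (pts c) r s) + smult (poly \<beta> (\<tau> c)) (quad (pts c) p q)
      + smult (poly \<gamma> (\<tau> c) * (1 - \<tau> c)) (quad (pts c) q r)"
    if c: "c \<in> S" for c \<alpha> \<beta> \<gamma>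
  proof -
    let ?\<phi> = "tetra_rep (pts c)" and ?\<tau> = "\<tau> c"
    note hom = tetra_rep_hom[OF inj_pts[OF c]] tetra_rep_minus[OF inj_pts[OF c]]
    have gens: "?\<phi> (tetra_x r s) = quad (pts c) r s" "?\<phi> (tetra_x p q) = quad (pts c) p q"
      "?\<phi> (tetra_x q r) = quad (pts c) q r"
      using tetra_rep_x[OF inj_pts[OF c]] d by auto
    have "(pts c q - pts c s) * (pts c p - pts c r) / ((pts c r - pts c s) * (pts c p - pts c q)) = ?\<tau>"
      using d by (auto simp: pts_def \<tau>_def minus_divide_left simp del: divide_minus_left)
    then have ef: "wronskian (?\<phi> (tetra_x r s + tetra_x q r)) (?\<phi> (tetra_x p q + tetra_x q r))
      = smult (- 4 * ?\<tau>) (?\<phi> (tetra_x q r))"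
      using quad_path_weights[where a = "pts c", OF ne(1-3)[OF c]] by (simp add: hom gens)
    \<comment> \<open>Here \<open>t\<close> is seen to act as the scalar
      \<open>\<tau> c\<close>.\<close>
    have z1: "?\<phi> P.z1 = smult ?\<tau> (?\<phi> (tetra_x q r))"
      by (simp add: P.z1_def hom(3-5) ef[simplified])
    have ze: "wronskian (?\<phi> (tetra_x q r)) (?\<phi> (tetra_x r s + tetra_x q r)) = smult 2 (?\<phi> (tetra_x r s + tetra_x q r))"
      and zf: "wronskian (?\<phi> (tetra_x q r)) (?\<phi> (tetra_x p q + tetra_x q r)) = smult (- 2) (?\<phi> (tetra_x p q + tetra_x q r))"
      using arg_cong[OF P.weight_e, of ?\<phi>] arg_cong[OF P.weight_f, of ?\<phi>] by (simp_all add: hom(3-5))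
    have ee: "?\<phi> (P.ee n) = smult (?\<tau> ^ n) (?\<phi> (tetra_x r s + tetra_x q r))" for n
      by (induction n)
        (simp_all add: P.ee.simps(2) hom(3-5) z1 ze wronskian.bracket_scale_left wronskian.bracket_scale_right mult_ac)
    have ff: "?\<phi> (P.ff n) = smult (?\<tau> ^ n) (?\<phi> (tetra_x p q + tetra_x q r))" for n
      by (induction n)
        (simp_all add: P.ff.simps(2) hom(3-5) z1 zf wronskian.bracket_scale_left wronskian.bracket_scale_right mult_ac)
    have zz: "?\<phi> (P.zz n) = smult (?\<tau> ^ n) (?\<phi> (tetra_x q r))" for n
      by (cases n)
        (simp_all add: P.zz.simps(2) hom(3-5) ee ef wronskian.bracket_scale_left mult_ac)
    have X: "?\<phi> (P.XX n) = smult (?\<tau> ^ n) (quad (pts c) r s)" for n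
      by (simp add: P.XX_def tetra_rep_diff[OF inj_pts[OF c]] ee zz hom(2) gens smult_add_right)
    have Y: "?\<phi> (P.YY n) = smult (?\<tau> ^ n) (quad (pts c) p q)" for n
      by (simp add: P.YY_def tetra_rep_diff[OF inj_pts[OF c]] ff zz hom(2) gens smult_add_right)
    have W: "?\<phi> (P.WW n) = smult (?\<tau> ^ n) (smult (1 - ?\<tau>) (quad (pts c) q r))" for n
    proof -
      have "?\<tau> ^ n - ?\<tau> ^ Suc n = ?\<tau> ^ n * (1 - ?\<tau>)"
        by (simp add: right_diff_distrib)
      then show ?thesis
        by (simp only: P.WW_def tetra_rep_diff[OF inj_pts[OF c]] zz gens smult_smult flip: smult_diff_left)
    qed
    note comb = tetra_rep_poly_comb[OF inj_pts[OF c]]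
    show ?thesis
      by (simp add: hom(2) comb[OF X] comb[OF Y] comb[OF W])
  qed
  have faithful: "u = 0" if "u \<in> Ons" and zero: "\<And>c. c \<in> S \<Longrightarrow> tetra_rep (pts c) u = 0" for u
  proof -
    obtain \<alpha> \<beta> \<gamma> where u: "u = tetra.poly_comb P.YY \<beta> + tetra.poly_comb P.WW \<gamma> + tetra.poly_comb P.XX \<alpha>"
      using decompose[OF \<open>u \<in> Ons\<close>] by (elim exE)
    have "poly \<alpha> (\<tau> c) = 0 \<and> poly \<beta> (\<tau> c) = 0 \<and> poly \<gamma> (\<tau> c) = 0" if "c \<in> S" for c
    proof -
      \<comment> \<open>\<open>\<tau> c = 1\<close> would force \<open>c = -1\<close>, which is
        excluded from \<open>S\<close>; hence the factor on the \<open>WW\<close> coordinate can be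
        cancelled.\<close>
      have "1 - \<tau> c \<noteq> 0"
        using that by (auto simp: \<tau>_def S_def field_simps eq_neg_iff_add_eq_0)
      then show ?thesis
        using quad_path_independent[where a = "pts c", OF ne[OF that] zero[OF that, unfolded u rep_u[OF that]]]
        by simp
    qed
    moreover have "\<delta> = 0" if "\<And>c. c \<in> S \<Longrightarrow> poly \<delta> (\<tau> c) = 0" for \<delta>
    proof (rule ccontr)
      assume "\<delta> \<noteq> 0"
      moreover have "\<tau> ` S \<subseteq> {t. poly \<delta> t = 0}"
        using that by auto
      ultimately show False
        using inf finite_subset[OF _ poly_roots_finite] by auto
    qed
    ultimately have "\<alpha> = 0" "\<beta> = 0" "\<gamma> = 0"
      by simp_all
    then show ?thesis
      by (simp add: u tetra.poly_comb_0)
  qed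
  have direct: "u = 0 \<and> v = 0 \<and> w = 0"
    if u: "u \<in> X_space p q \<inter> Ons" and v: "v \<in> X_space q r \<inter> Ons" and w: "w \<in> X_space r s \<inter> Ons"
      and sum: "u + v + w = 0" for u v w
  proof -
    have "tetra_rep (pts c) u = 0 \<and> tetra_rep (pts c) v = 0 \<and> tetra_rep (pts c) w = 0" if c: "c \<in> S" for c
    proof -
      let ?\<phi> = "tetra_rep (pts c)"
      note hom = tetra_rep_hom[OF inj_pts[OF c]]
      have zeros: "poly (?\<phi> y) (pts c i) = 0 \<and> poly (?\<phi> y) (pts c j) = 0"
        if "y \<in> X_space i j" "i \<noteq> j" for y i j
      proof -
        have "wronskian (quad (pts c) i j) (?\<phi> y) = ?\<phi> (tetra_bracket (tetra_x i j) y)"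
          by (simp add: hom(4) tetra_rep_x[OF inj_pts[OF c] that(2)])
        also have "\<dots> = 0"
          using that(1) by (simp add: X_space_def x_like_def hom(1))
        finally have "wronskian (quad (pts c) i j) (?\<phi> y) = 0" .
        moreover have "pts c i \<noteq> pts c j"
          using inj_pts[OF c] that(2) by (auto simp: inj_eq)
        ultimately show ?thesis
          using quad_centralizer[where a = "pts c" and i = i and j = j] by simp
      qed
      have coords: "\<exists>A B C. ?\<phi> y = smult A (quad (pts c) r s) + smult B (quad (pts c) p q) + smult C (quad (pts c) q r)"
        if y_in: "y \<in> Ons" for y
      proof -
        obtain \<alpha> \<beta> \<gamma> where y: "y = tetra.poly_comb P.YY \<beta> + tetra.poly_comb P.WW \<gamma> + tetra.poly_comb P.XX \<alpha>"
          using decompose[OF y_in] by (elim exE)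
        show ?thesis
          unfolding y rep_u[OF c] by (intro exI) (rule HOL.refl)
      qed
      obtain A1 B1 C1 where U:
        "?\<phi> u = smult A1 (quad (pts c) r s) + smult B1 (quad (pts c) p q) + smult C1 (quad (pts c) q r)"
        using coords[OF IntD2[OF u]] by (elim exE)
      obtain A2 B2 C2 where V:
        "?\<phi> v = smult A2 (quad (pts c) r s) + smult B2 (quad (pts c) p q) + smult C2 (quad (pts c) q r)"
        using coords[OF IntD2[OF v]] by (elim exE)
      obtain A3 B3 C3 where W:
        "?\<phi> w = smult A3 (quad (pts c) r s) + smult B3 (quad (pts c) p q) + smult C3 (quad (pts c) q r)"
        using coords[OF IntD2[OF w]] by (elim exE)
      have sum': "?\<phi> u + ?\<phi> v + ?\<phi> w = 0"
        using arg_cong[OF sum, of ?\<phi>] by (simp add: hom(1,2))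
      have neq: "p \<noteq> q" "q \<noteq> r" "r \<noteq> s"
        using d by auto
      note Z = zeros[OF IntD1[OF u] neq(1)] zeros[OF IntD1[OF v] neq(2)] zeros[OF IntD1[OF w] neq(3)]
      note direct = quad_path_direct[where a = "pts c", OF ne[OF c] U V W
          conjunct1[OF Z(1)] conjunct2[OF Z(1)] conjunct1[OF Z(2)] conjunct2[OF Z(2)]
          conjunct1[OF Z(3)] conjunct2[OF Z(3)] sum']
      show ?thesis
        by (intro conjI direct)
    qed
    then show ?thesis
      using faithful[OF IntD2[OF u]] faithful[OF IntD2[OF v]] faithful[OF IntD2[OF w]] by simp
  qed
  show "direct_sum3 (X_space p q \<inter> Ons) (X_space q r \<inter> Ons) (X_space r s \<inter> Ons)"
    unfolding direct_sum3_def
  proof (rule inj_onI)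
    fix t t'
    assume t: "t \<in> (X_space p q \<inter> Ons) \<times> (X_space q r \<inter> Ons) \<times> (X_space r s \<inter> Ons)"
      and t': "t' \<in> (X_space p q \<inter> Ons) \<times> (X_space q r \<inter> Ons) \<times> (X_space r s \<inter> Ons)"
      and sums: "(\<lambda>(u, v, w). u + v + w) t = (\<lambda>(u, v, w). u + v + w) t'"
    obtain u v w u' v' w' where tt': "t = (u, v, w)" "t' = (u', v', w')"
      by (metis prod_cases3)
    have eq: "u + v + w = u' + v' + w'"
      using sums by (simp add: tt')
    have "u - u' \<in> X_space p q \<inter> Ons" "v - v' \<in> X_space q r \<inter> Ons" "w - w' \<in> X_space r s \<inter> Ons"
      using t t' tetra.subspace_diff[OF sub] tetra.subspace_diff[OF subspace_X_space] by (auto simp: tt')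
    moreover have "(u - u') + (v - v') + (w - w') = 0"
      using eq by (simp add: algebra_simps)
    ultimately have "u - u' = 0 \<and> v - v' = 0 \<and> w - w' = 0"
      by (rule direct)
    then show "t = t'" by (simp add: tt')
  qed
qed

text \<open>Used to identify the subalgebras of the four paths, whose end edges carry different
  orientations.\<close>

lemma lie_subalgebra_hull_neg:
  fixes u v :: "'f::field_char_0 tetra"
  assumes "u' \<in> {u, - u}" and "v' \<in> {v, - v}"
  shows "tetra.lie_subalgebra hull {u', v'} = tetra.lie_subalgebra hull {u, v}"
proof -
  have "- y \<in> S \<longleftrightarrow> y \<in> S" if "tetra.lie_subalgebra S" for y :: "'f tetra" and S
    using that tetra.subspace_neg[of S] unfolding tetra.lie_subalgebra_def by force
  then have "tetra.lie_subalgebra S \<and> {u', v'} \<subseteq> S \<longleftrightarrow> tetra.lie_subalgebra S \<and> {u, v} \<subseteq> S" for S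
    using assms by auto
  then show ?thesis
    unfolding hull_def by simp
qed

theorem corollary5p4:
  "let Ons = (O_sub :: 'f::field_char_0 tetra set) in
     Ons = (X_space 0 3 \<inter> Ons) + (X_space 3 1 \<inter> Ons) + (X_space 1 2 \<inter> Ons) \<and>
     direct_sum3 (X_space 0 3 \<inter> Ons) (X_space 3 1 \<inter> Ons) (X_space 1 2 \<inter> Ons) \<and>
     Ons = (X_space 3 0 \<inter> Ons) + (X_space 0 2 \<inter> Ons) + (X_space 2 1 \<inter> Ons) \<and>
     direct_sum3 (X_space 3 0 \<inter> Ons) (X_space 0 2 \<inter> Ons) (X_space 2 1 \<inter> Ons) \<and>
     Ons = (X_space 0 3 \<inter> Ons) + (X_space 3 2 \<inter> Ons) + (X_space 2 1 \<inter> Ons) \<and>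
     direct_sum3 (X_space 0 3 \<inter> Ons) (X_space 3 2 \<inter> Ons) (X_space 2 1 \<inter> Ons) \<and>
     Ons = (X_space 3 0 \<inter> Ons) + (X_space 0 1 \<inter> Ons) + (X_space 1 2 \<inter> Ons) \<and>
     direct_sum3 (X_space 3 0 \<inter> Ons) (X_space 0 1 \<inter> Ons) (X_space 1 2 \<inter> Ons)"
proof -
  have flip: "tetra_x 2 1 = - (tetra_x 1 2 :: 'f tetra)" "tetra_x 3 0 = - (tetra_x 0 3 :: 'f tetra)"
    by (rule tetra_x_flip; simp)+
  have Ons: "tetra.lie_subalgebra hull {tetra_x 1 2, tetra_x 0 3} = (O_sub :: 'f tetra set)"
    "tetra.lie_subalgebra hull {tetra_x 2 1, tetra_x 3 0} = (O_sub :: 'f tetra set)"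
    "tetra.lie_subalgebra hull {tetra_x 2 1, tetra_x 0 3} = (O_sub :: 'f tetra set)"
    "tetra.lie_subalgebra hull {tetra_x 1 2, tetra_x 3 0} = (O_sub :: 'f tetra set)"
    unfolding O_sub_eq_generated by (rule lie_subalgebra_hull_neg; simp add: flip)+
  \<comment> \<open>Each path has 03 as first edge and 12 as last edge; the four choices of their
    orientations give the four decompositions.\<close>
  have "distinct [0, 3, 1, 2 :: 4]" "distinct [3, 0, 2, 1 :: 4]" "distinct [0, 3, 2, 1 :: 4]" "distinct [3, 0, 1, 2 :: 4]"
    by simp_all
  show ?thesis
    unfolding Let_def
    using onsager_decomposition[OF \<open>distinct [0, 3, 1, 2]\<close>, where 'f = 'f]
      onsager_decomposition[OF \<open>distinct [3, 0, 2, 1]\<close>, where 'f = 'f]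
      onsager_decomposition[OF \<open>distinct [0, 3, 2, 1]\<close>, where 'f = 'f]
      onsager_decomposition[OF \<open>distinct [3, 0, 1, 2]\<close>, where 'f = 'f]
    unfolding Ons by (intro conjI)
qed

end
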